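(* Let $m\in\mathbb{N}$, let $E_1,\ldots,E_m,F$ be Riesz spaces, let $A\in\mathcal{L}_r(E_1,\ldots,E_m;F)$ be a Riesz multimorphism and let $\rho\in S_m$. For every Riesz homomorphism $y'\in F^\sim$, the map $J_{F^\sim}(y')\circ AR_m^\rho(A)\colon E_1^{\sim\sim}\times\cdots\times E_m^{\sim\sim}\to\mathbb{R}$ is a Riesz multimorphism and $$|AR_m^\rho(A)(x_1'',\ldots,x_m'')|(y')=AR_m^\rho(A)(|x_1''|,\ldots,|x_m''|)(y')$$ for all $x_1''\in E_1^{\sim\sim},\ldots,x_m''\in E_m^{\sim\sim}$.
   Context: All Riesz spaces are real. $E^\sim$ is the order dual of a Riesz space $E$ (the order bounded, equivalently regular, linear functionals) and $E^{\sim\sim}=(E^\sim)^\sim$. For a Riesz space $E$, $J_E\colon E\to E^{\sim\sim}$ is the canonical operator, $J_E(x)(x')=x'(x)$; in particular $J_{F^\sim}(y')(y'')=y''(y')$ for $y'\in F^\sim$, $y''\in F^{\sim\sim}$. $S_m$ is the set of permutations of $\{1,\ldots,m\}$. An $m$-linear operator $A\colon E_1\times\cdots\times E_m\to F$ between Riesz spaces is positive if $A(x_1,\ldots,x_m)\ge 0$ whenever all $x_i\ge 0$, and regular if it is a difference of two positive $m$-linear operators; $\mathcal{L}_r(E_1,\ldots,E_m;F)$ is the space of regular $m$-linear operators. A Riesz multimorphism is an $A\in\mathcal{L}_r(E_1,\ldots,E_m;F)$ with $|A(x_1,\ldots,x_m)|=A(|x_1|,\ldots,|x_m|)$ for all $x_i\in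 E_i$. Arens extensions: fix $\rho\in S_m$. For $0\le k\le m$ let $I_k=\{1,\ldots,m\}\setminus\{\rho(1),\ldots,\rho(k)\}$ and let $\mathcal{L}^{\rho,k}$ be the space of regular $(m-k)$-linear forms on the product of the spaces $E_i$, $i\in I_k$ (in increasing order of indices), with $\mathcal{L}^{\rho,m}=\mathbb{R}$. For $1\le k\le m$ and $x''\in E_{\rho(k)}^{\sim\sim}$ define $\overline{x''}^{\rho}\colon\mathcal{L}^{\rho,k-1}\to\mathcal{L}^{\rho,k}$ by letting $\overline{x''}^{\rho}(B)\big((x_i)_{i\in I_k}\big)$ be the value of $x''$ at the functional $x_{\rho(k)}\mapsto B\big((x_i)_{i\in I_{k-1}}\big)$ in $E_{\rho(k)}^\sim$. For $A\in\mathcal{L}_r(E_1,\ldots,E_m;F)$ the Arens extension $AR_m^\rho(A)\colon E_1^{\sim\sim}\times\cdots\times E_m^{\sim\sim}\to F^{\sim\sim}$ is $$AR_m^\rho(A)(x_1'',\ldots,x_m'')(y')=\big(\overline{x_{\rho(m)}''}^{\rho}\circ\cdots\circ\overline{x_{\rho(1)}''}^{\rho}\big)(y'\circ A),\quad y'\in F^\sim.$$ *)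

theory Defs
  imports Complex_Main "HOL-Library.FuncSet" "HOL-Combinatorics.Permutations" "HOL-Algebra.Lattice"
begin

section \<open>Riesz spaces\<close>

text \<open>
  The spaces \<open>E\<^sub>1, \<dots>, E\<^sub>m\<close> are unrelated to each other and their number varies, so Riesz
  spaces are structures with an explicit carrier. A finite family of Riesz spaces can always be
  realised on carriers inside one common type, so a family \<open>E :: nat \<Rightarrow> 'a riesz\<close> is no
  restriction.
\<close>

record 'a riesz = "'a gorder" +
  vadd :: "'a \<Rightarrow> 'a \<Rightarrow> 'a" (infixl "\<boxplus>\<index>" 65)
  vzero :: 'a
  vscale :: "real \<Rightarrow> 'a \<Rightarrow> 'a" (infixr "\<cdot>\<index>" 75)

locale riesz_space = lattice E for E :: "('a, 'b) riesz_scheme" (structure) +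
  assumes vadd_closed: "\<lbrakk>x \<in> carrier E; y \<in> carrier E\<rbrakk> \<Longrightarrow> x \<boxplus> y \<in> carrier E"
    and vzero_closed: "vzero E \<in> carrier E"
    and vscale_closed: "x \<in> carrier E \<Longrightarrow> c \<cdot> x \<in> carrier E"
    and vadd_assoc:
      "\<lbrakk>x \<in> carrier E; y \<in> carrier E; z \<in> carrier E\<rbrakk> \<Longrightarrow> (x \<boxplus> y) \<boxplus> z = x \<boxplus> (y \<boxplus> z)"
    and vadd_commute: "\<lbrakk>x \<in> carrier E; y \<in> carrier E\<rbrakk> \<Longrightarrow> x \<boxplus> y = y \<boxplus> x"
    and vzero_left: "x \<in> carrier E \<Longrightarrow> vzero E \<boxplus> x = x"
    and vneg_right: "x \<in> carrier E \<Longrightarrow> x \<boxplus> (-1) \<cdot> x = vzero E"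
    and vscale_add_right:
      "\<lbrakk>x \<in> carrier E; y \<in> carrier E\<rbrakk> \<Longrightarrow> c \<cdot> (x \<boxplus> y) = c \<cdot> x \<boxplus> c \<cdot> y"
    and vscale_add_left: "x \<in> carrier E \<Longrightarrow> (c + d) \<cdot> x = c \<cdot> x \<boxplus> d \<cdot> x"
    and vscale_vscale: "x \<in> carrier E \<Longrightarrow> c \<cdot> d \<cdot> x = (c * d) \<cdot> x"
    and vscale_one: "x \<in> carrier E \<Longrightarrow> 1 \<cdot> x = x"
    and vadd_mono:
      "\<lbrakk>x \<in> carrier E; y \<in> carrier E; z \<in> carrier E; x \<sqsubseteq> y\<rbrakk> \<Longrightarrow> x \<boxplus> z \<sqsubseteq> y \<boxplus> z"
    and vscale_mono:
      "\<lbrakk>x \<in> carrier E; y \<in> carrier E; x \<sqsubseteq> y; 0 \<le> c\<rbrakk> \<Longrightarrow> c \<cdot> x \<sqsubseteq> c \<cdot> y"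

definition riesz_abs :: "'a riesz \<Rightarrow> 'a \<Rightarrow> 'a" where
  "riesz_abs E x = x \<squnion>\<^bsub>E\<^esub> ((-1) \<cdot>\<^bsub>E\<^esub> x)"

definition real_riesz :: "real riesz" where
  "real_riesz = \<lparr>carrier = UNIV, eq = (=), le = (\<le>), vadd = (+), vzero = 0, vscale = (*)\<rparr>"

lemma real_riesz_simps [simp]:
  "carrier real_riesz = UNIV" "(.=\<^bsub>real_riesz\<^esub>) = (=)" "le real_riesz = (\<le>)"
  "vadd real_riesz = (+)" "vzero real_riesz = 0" "vscale real_riesz = (*)"
  by (simp_all add: real_riesz_def)

lemma least_Upper_real_riesz: "least real_riesz (max x y) (Upper real_riesz {x, y})"
  by (auto simp: least_def Upper_def)

lemma greatest_Lower_real_riesz: "greatest real_riesz (min x y) (Lower real_riesz {x, y})"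
  by (auto simp: greatest_def Lower_def)

lemma riesz_space_real_riesz: "riesz_space real_riesz"
proof -
  interpret partial_order real_riesz
    by unfold_locales auto
  show ?thesis
    by unfold_locales
      (use least_Upper_real_riesz greatest_Lower_real_riesz in
        \<open>auto simp: distrib_left distrib_right mult_left_mono intro!: exI\<close>)
qed

lemma riesz_abs_real_riesz: "riesz_abs real_riesz x = \<bar>x\<bar>"
proof -
  interpret riesz_space real_riesz by (rule riesz_space_real_riesz)
  have "x \<squnion>\<^bsub>real_riesz\<^esub> (- x) = max x (- x)"
    unfolding join_def
    using least_unique least_Upper_real_riesz sup_def
    by (metis someI_ex)
  then show ?thesis by (simp add: riesz_abs_def)
qed


section \<open>Linear operators and the order dual\<close>

definition riesz_linear :: "'a riesz \<Rightarrow> 'b riesz \<Rightarrow> ('a \<Rightarrow> 'b) \<Rightarrow> bool" where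
  "riesz_linear E F T \<longleftrightarrow>
     T \<in> carrier E \<rightarrow> carrier F \<and>
     (\<forall>x\<in>carrier E. \<forall>y\<in>carrier E. T (x \<boxplus>\<^bsub>E\<^esub> y) = T x \<boxplus>\<^bsub>F\<^esub> T y) \<and>
     (\<forall>c. \<forall>x\<in>carrier E. T (c \<cdot>\<^bsub>E\<^esub> x) = c \<cdot>\<^bsub>F\<^esub> T x)"

definition riesz_hom :: "'a riesz \<Rightarrow> 'b riesz \<Rightarrow> ('a \<Rightarrow> 'b) \<Rightarrow> bool" where
  "riesz_hom E F T \<longleftrightarrow>
     riesz_linear E F T \<and>
     (\<forall>x\<in>carrier E. \<forall>y\<in>carrier E. T (x \<squnion>\<^bsub>E\<^esub> y) = T x \<squnion>\<^bsub>F\<^esub> T y)"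

definition order_bounded :: "'a riesz \<Rightarrow> ('a \<Rightarrow> real) \<Rightarrow> bool" where
  "order_bounded E f \<longleftrightarrow>
     (\<forall>a\<in>carrier E. \<forall>b\<in>carrier E. \<exists>M. \<forall>x\<in>carrier E. a \<sqsubseteq>\<^bsub>E\<^esub> x \<and> x \<sqsubseteq>\<^bsub>E\<^esub> b \<longrightarrow> \<bar>f x\<bar> \<le> M)"

text \<open>
  Functionals are taken to be \<^const>\<open>extensional\<close>, so that each functional on the carrier is
  represented by exactly one element of the order dual.
\<close>

definition order_dual :: "'a riesz \<Rightarrow> ('a \<Rightarrow> real) riesz" where
  "order_dual E =
     \<lparr>carrier = {f \<in> extensional (carrier E). riesz_linear E real_riesz f \<and> order_bounded E f},
      eq = (=),
      le = (\<lambda>f g. \<forall>x\<in>carrier E. vzero E \<sqsubseteq>\<^bsub>E\<^esub> x \<longrightarrow> f x \<le> g x),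
      vadd = (\<lambda>f g. \<lambda>x\<in>carrier E. f x + g x),
      vzero = (\<lambda>x\<in>carrier E. 0),
      vscale = (\<lambda>c f. \<lambda>x\<in>carrier E. c * f x)\<rparr>"

abbreviation order_bidual :: "'a riesz \<Rightarrow> (('a \<Rightarrow> real) \<Rightarrow> real) riesz" where
  "order_bidual E \<equiv> order_dual (order_dual E)"

definition canonical_op :: "'a riesz \<Rightarrow> 'a \<Rightarrow> ('a \<Rightarrow> real) \<Rightarrow> real" where
  "canonical_op E x = (\<lambda>x'\<in>carrier (order_dual E). x' x)"


section \<open>Multilinear operators\<close>

text \<open>
  Operators on \<open>\<Prod>\<^sub>i\<^sub>\<in>\<^sub>I E\<^sub>i\<close> for a set \<open>I\<close> of indices; only the values on the product matter.
  The product over the empty set is the singleton \<open>{\<lambda>_. undefined}\<close>.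
\<close>

abbreviation riesz_prod :: "nat set \<Rightarrow> (nat \<Rightarrow> 'a riesz) \<Rightarrow> (nat \<Rightarrow> 'a) set" where
  "riesz_prod I E \<equiv> \<Pi>\<^sub>E i\<in>I. carrier (E i)"

definition multilinear ::
  "nat set \<Rightarrow> (nat \<Rightarrow> 'a riesz) \<Rightarrow> 'b riesz \<Rightarrow> ((nat \<Rightarrow> 'a) \<Rightarrow> 'b) \<Rightarrow> bool" where
  "multilinear I E F A \<longleftrightarrow>
     A \<in> riesz_prod I E \<rightarrow> carrier F \<and>
     (\<forall>x\<in>riesz_prod I E. \<forall>i\<in>I. \<forall>u\<in>carrier (E i). \<forall>v\<in>carrier (E i).
        A (x(i := u \<boxplus>\<^bsub>E i\<^esub> v)) = A (x(i := u)) \<boxplus>\<^bsub>F\<^esub> A (x(i := v))) \<and>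
     (\<forall>x\<in>riesz_prod I E. \<forall>i\<in>I. \<forall>u\<in>carrier (E i). \<forall>c.
        A (x(i := c \<cdot>\<^bsub>E i\<^esub> u)) = c \<cdot>\<^bsub>F\<^esub> A (x(i := u)))"

definition positive_multilinear ::
  "nat set \<Rightarrow> (nat \<Rightarrow> 'a riesz) \<Rightarrow> 'b riesz \<Rightarrow> ((nat \<Rightarrow> 'a) \<Rightarrow> 'b) \<Rightarrow> bool" where
  "positive_multilinear I E F A \<longleftrightarrow>
     multilinear I E F A \<and>
     (\<forall>x\<in>riesz_prod I E. (\<forall>i\<in>I. vzero (E i) \<sqsubseteq>\<^bsub>E i\<^esub> x i) \<longrightarrow> vzero F \<sqsubseteq>\<^bsub>F\<^esub> A x)"

definition regular_multilinear ::
  "nat set \<Rightarrow> (nat \<Rightarrow> 'a riesz) \<Rightarrow> 'b riesz \<Rightarrow> ((nat \<Rightarrow> 'a) \<Rightarrow> 'b) \<Rightarrow> bool" where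
  "regular_multilinear I E F A \<longleftrightarrow>
     (\<exists>P N. positive_multilinear I E F P \<and> positive_multilinear I E F N \<and>
        (\<forall>x\<in>riesz_prod I E. A x = P x \<boxplus>\<^bsub>F\<^esub> (-1) \<cdot>\<^bsub>F\<^esub> N x))"

definition riesz_multimorphism ::
  "nat set \<Rightarrow> (nat \<Rightarrow> 'a riesz) \<Rightarrow> 'b riesz \<Rightarrow> ((nat \<Rightarrow> 'a) \<Rightarrow> 'b) \<Rightarrow> bool" where
  "riesz_multimorphism I E F A \<longleftrightarrow>
     regular_multilinear I E F A \<and>
     (\<forall>x\<in>riesz_prod I E. riesz_abs F (A x) = A (\<lambda>i\<in>I. riesz_abs (E i) (x i)))"


section \<open>Arens extensions\<close>

text \<open>The index set \<open>I\<^sub>k = {1, \<dots>, m} - {\<rho> 1, \<dots>, \<rho> k}\<close>.\<close>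

definition arens_index :: "nat \<Rightarrow> (nat \<Rightarrow> nat) \<Rightarrow> nat \<Rightarrow> nat set" where
  "arens_index m \<rho> k = {1..m} - \<rho> ` {1..k}"

text \<open>
  For \<open>1 \<le> k \<le> m\<close> and \<open>x''\<close> in the bidual of \<open>E (\<rho> k)\<close>, this sends a regular form \<open>B\<close> on the
  product over \<open>I\<^sub>k\<^sub>-\<^sub>1\<close> to a regular form on the product over \<open>I\<^sub>k\<close>. If \<open>x\<close> lies in the latter
  product and \<open>t\<close> in \<open>E (\<rho> k)\<close>, then \<open>x(\<rho> k := t)\<close> lies in the former.
\<close>

definition arens_bar ::
  "nat \<Rightarrow> (nat \<Rightarrow> nat) \<Rightarrow> (nat \<Rightarrow> 'a riesz) \<Rightarrow> nat \<Rightarrow> (('a \<Rightarrow> real) \<Rightarrow> real) \<Rightarrow>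
     ((nat \<Rightarrow> 'a) \<Rightarrow> real) \<Rightarrow> ((nat \<Rightarrow> 'a) \<Rightarrow> real)" where
  "arens_bar m \<rho> E k x'' B =
     (\<lambda>x\<in>riesz_prod (arens_index m \<rho> k) E. x'' (\<lambda>t\<in>carrier (E (\<rho> k)). B (x(\<rho> k := t))))"

primrec arens_comp ::
  "nat \<Rightarrow> (nat \<Rightarrow> nat) \<Rightarrow> (nat \<Rightarrow> 'a riesz) \<Rightarrow> nat \<Rightarrow> (nat \<Rightarrow> ('a \<Rightarrow> real) \<Rightarrow> real) \<Rightarrow>
     ((nat \<Rightarrow> 'a) \<Rightarrow> real) \<Rightarrow> ((nat \<Rightarrow> 'a) \<Rightarrow> real)" where
  "arens_comp m \<rho> E 0 x'' = id"
| "arens_comp m \<rho> E (Suc k) x'' =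
     arens_bar m \<rho> E (Suc k) (x'' (\<rho> (Suc k))) \<circ> arens_comp m \<rho> E k x''"

text \<open>
  After \<open>m\<close> steps the index set is empty, and the resulting \<open>0\<close>-linear form is identified with the
  real number that is its value at the empty family.
\<close>

definition arens_extension ::
  "nat \<Rightarrow> (nat \<Rightarrow> nat) \<Rightarrow> (nat \<Rightarrow> 'a riesz) \<Rightarrow> 'b riesz \<Rightarrow> ((nat \<Rightarrow> 'a) \<Rightarrow> 'b) \<Rightarrow>
     (nat \<Rightarrow> ('a \<Rightarrow> real) \<Rightarrow> real) \<Rightarrow> ('b \<Rightarrow> real) \<Rightarrow> real" where
  "arens_extension m \<rho> E F A x'' =
     (\<lambda>y'\<in>carrier (order_dual F).
        arens_comp m \<rho> E m x'' (compose (riesz_prod {1..m} E) y' A) (\<lambda>_. undefined))"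

end

theory Submission
  imports Defs
begin

text \<open>
  The composition of \<open>A\<close> with a real Riesz homomorphism \<open>y'\<close> is a real Riesz multimorphism, and such a
  form is a product \<open>c \<cdot> \<phi>\<^sub>1(x\<^sub>1) \<cdots> \<phi>\<^sub>m(x\<^sub>m)\<close> with \<open>c \<ge> 0\<close> and real Riesz homomorphisms \<open>\<phi>\<^sub>i\<close>, because
  functionals dominated by a real Riesz homomorphism \<open>h\<close> vanish on its kernel and hence are multiples
  of \<open>h\<close>. Whatever the order \<open>\<rho>\<close>, its Arens extension is therefore \<open>c \<cdot> x\<^sub>1''(\<phi>\<^sub>1) \<cdots> x\<^sub>m''(\<phi>\<^sub>m)\<close>.
  The interval \<open>[0, \<phi>]\<close> of the order dual consists of multiples of \<open>\<phi>\<close>, so the Riesz--Kantorovich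
  formula gives \<open>\<bar>x''\<bar>(\<phi>) = \<bar>x''(\<phi>)\<bar>\<close>. The same identity at \<open>y'\<close> yields the second claim, once the
  values of the Arens extension are known to be order bounded; this holds because domination of
  forms is preserved by each step of the extension.
\<close>

section \<open>Elementary properties of Riesz spaces\<close>

text \<open>The locale \<open>riesz_space\<close> admits extensions of the record; here the type is
  fixed to \<open>'a riesz\<close>, on which \<open>riesz_abs\<close> and \<open>order_dual\<close>
  are defined.\<close>

locale riesz = riesz_space E for E :: "'a riesz" (structure)
begin

declare vadd_closed [simp] vzero_closed [simp] vscale_closed [simp] vscale_one [simp]
  vzero_left [simp] vneg_right [simp]

section \<open>Arithmetic of the underlying vector space\<close>

lemma vadd_left_commute:
  "\<lbrakk>x \<in> carrier E; y \<in> carrier E; z \<in> carrier E\<rbrakk> \<Longrightarrow> x \<boxplus> (y \<boxplus> z) = y \<boxplus> (x \<boxplus> z)"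
  by (metis vadd_assoc vadd_commute)

lemmas vadd_ac = vadd_assoc vadd_commute vadd_left_commute

lemma vzero_right [simp]: "x \<in> carrier E \<Longrightarrow> x \<boxplus> vzero E = x"
  by (metis vadd_commute vzero_closed vzero_left)

lemma vneg_left [simp]: "x \<in> carrier E \<Longrightarrow> (-1) \<cdot> x \<boxplus> x = vzero E"
  by (metis vadd_commute vneg_right vscale_closed)

abbreviation vminus :: "'a \<Rightarrow> 'a \<Rightarrow> 'a" (infixl "\<boxminus>" 65) where
  "x \<boxminus> y \<equiv> x \<boxplus> (-1) \<cdot> y"

lemma vminus_vadd [simp]: "\<lbrakk>x \<in> carrier E; y \<in> carrier E\<rbrakk> \<Longrightarrow> x \<boxminus> y \<boxplus> y = x"
  by (simp add: vadd_assoc)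

lemma vadd_vminus [simp]: "\<lbrakk>x \<in> carrier E; y \<in> carrier E\<rbrakk> \<Longrightarrow> x \<boxplus> y \<boxminus> y = x"
  by (simp add: vadd_assoc)

lemma vminus_vminus [simp]:
  assumes [simp]: "x \<in> carrier E" "y \<in> carrier E"
  shows "x \<boxminus> (x \<boxminus> y) = y"
proof -
  have "y \<boxplus> (x \<boxminus> y) = x" by (simp add: vadd_commute[of y])
  then show ?thesis by (metis assms vadd_closed vadd_vminus vscale_closed)
qed

lemma vadd_right_cancel:
  assumes "x \<in> carrier E" "y \<in> carrier E" "z \<in> carrier E"
  shows "x \<boxplus> z = y \<boxplus> z \<longleftrightarrow> x = y"
  by (metis assms vadd_vminus)

lemma vscale_vzero [simp]: "c \<cdot> vzero E = vzero E"
  by (metis vadd_right_cancel vscale_add_right vscale_closed vzero_closed vzero_left)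

lemma vscale_zero [simp]: "x \<in> carrier E \<Longrightarrow> 0 \<cdot> x = vzero E"
  by (metis add.right_neutral vadd_right_cancel vscale_add_left vscale_closed vzero_closed vzero_left)

section \<open>Compatibility of the order with the vector space operations\<close>

lemma vadd_mono_both:
  assumes "x \<sqsubseteq> y" "u \<sqsubseteq> v" and [simp]: "x \<in> carrier E" "y \<in> carrier E" "u \<in> carrier E" "v \<in> carrier E"
  shows "x \<boxplus> u \<sqsubseteq> y \<boxplus> v"
proof -
  have "x \<boxplus> u \<sqsubseteq> y \<boxplus> u" using assms by (simp add: vadd_mono)
  moreover have "y \<boxplus> u \<sqsubseteq> y \<boxplus> v"
    using assms vadd_mono[of u v y] by (simp add: vadd_commute)
  ultimately show ?thesis by (rule le_trans) simp_all
qed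

lemma vadd_le_cancel_right:
  assumes "x \<in> carrier E" "y \<in> carrier E" "z \<in> carrier E"
  shows "x \<boxplus> z \<sqsubseteq> y \<boxplus> z \<longleftrightarrow> x \<sqsubseteq> y"
  by (metis assms vadd_closed vadd_mono vadd_vminus vscale_closed)

lemma le_vminus_iff:
  assumes "x \<in> carrier E" "y \<in> carrier E" "z \<in> carrier E"
  shows "x \<sqsubseteq> y \<boxminus> z \<longleftrightarrow> x \<boxplus> z \<sqsubseteq> y"
  by (metis assms vadd_closed vadd_le_cancel_right vminus_vadd vscale_closed)

lemma vminus_le_iff:
  assumes "x \<in> carrier E" "y \<in> carrier E" "z \<in> carrier E"
  shows "x \<boxminus> z \<sqsubseteq> y \<longleftrightarrow> x \<sqsubseteq> y \<boxplus> z"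
  by (metis assms vadd_closed vadd_le_cancel_right vminus_vadd vscale_closed)

lemma vminus_nonneg_iff:
  "\<lbrakk>x \<in> carrier E; y \<in> carrier E\<rbrakk> \<Longrightarrow> vzero E \<sqsubseteq> x \<boxminus> y \<longleftrightarrow> y \<sqsubseteq> x"
  by (simp add: le_vminus_iff)

lemma vadd_nonneg:
  "\<lbrakk>vzero E \<sqsubseteq> x; vzero E \<sqsubseteq> y; x \<in> carrier E; y \<in> carrier E\<rbrakk> \<Longrightarrow> vzero E \<sqsubseteq> x \<boxplus> y"
  using vadd_mono_both[of "vzero E" x "vzero E" y] by simp

lemma vscale_nonneg:
  "\<lbrakk>0 \<le> c; vzero E \<sqsubseteq> x; x \<in> carrier E\<rbrakk> \<Longrightarrow> vzero E \<sqsubseteq> c \<cdot> x"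
  using vscale_mono[of "vzero E" x c] by simp

lemma vneg_vneg [simp]: "x \<in> carrier E \<Longrightarrow> (-1) \<cdot> (-1) \<cdot> x = x"
  by (simp add: vscale_vscale)

lemma vneg_antimono:
  assumes "x \<sqsubseteq> y" and [simp]: "x \<in> carrier E" "y \<in> carrier E"
  shows "(-1) \<cdot> y \<sqsubseteq> (-1) \<cdot> x"
proof -
  have "vzero E \<sqsubseteq> (-1) \<cdot> x \<boxminus> (-1) \<cdot> y"
    using assms by (simp add: vadd_commute vminus_nonneg_iff)
  then show ?thesis by (simp only: vminus_nonneg_iff vscale_closed assms)
qed

lemma vminus_le_self:
  assumes "vzero E \<sqsubseteq> y" "x \<in> carrier E" "y \<in> carrier E"
  shows "x \<boxminus> y \<sqsubseteq> x"
  using assms vadd_mono_both[of x x "vzero E" y] by (simp add: vminus_le_iff)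

section \<open>Absolute value and decompositions into positive elements\<close>

lemma abs_closed [simp]: "x \<in> carrier E \<Longrightarrow> riesz_abs E x \<in> carrier E"
  by (simp add: riesz_abs_def)

lemma le_abs: "x \<in> carrier E \<Longrightarrow> x \<sqsubseteq> riesz_abs E x"
  by (simp add: riesz_abs_def join_left)

lemma neg_le_abs: "x \<in> carrier E \<Longrightarrow> (-1) \<cdot> x \<sqsubseteq> riesz_abs E x"
  by (simp add: riesz_abs_def join_right)

text \<open>Adding \<open>x \<le> |x|\<close> and \<open>-x \<le> |x|\<close> gives
  \<open>0 \<le> 2|x|\<close>, and halving preserves this.\<close>

lemma abs_nonneg:
  assumes [simp]: "x \<in> carrier E"
  shows "vzero E \<sqsubseteq> riesz_abs E x"
proof -
  have "vzero E \<sqsubseteq> riesz_abs E x \<boxplus> riesz_abs E x"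
    using vadd_mono_both[OF le_abs[OF assms] neg_le_abs[OF assms]] by simp
  also have "\<dots> = 2 \<cdot> riesz_abs E x"
    using vscale_add_left[of "riesz_abs E x" 1 1] by simp
  finally have "vzero E \<sqsubseteq> (1 / 2) \<cdot> 2 \<cdot> riesz_abs E x"
    by (rule vscale_nonneg[rotated]) simp_all
  then show ?thesis by (simp add: vscale_vscale)
qed

lemma abs_of_nonneg:
  assumes "vzero E \<sqsubseteq> x" and [simp]: "x \<in> carrier E"
  shows "riesz_abs E x = x"
proof -
  have "(-1) \<cdot> x \<sqsubseteq> vzero E" using vneg_antimono[of "vzero E" x] assms by simp
  then have "(-1) \<cdot> x \<sqsubseteq> x" by (rule le_trans) (use assms in simp_all)
  then have "riesz_abs E x \<sqsubseteq> x" by (simp add: riesz_abs_def join_le)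
  moreover have "x \<sqsubseteq> riesz_abs E x" by (simp add: le_abs)
  ultimately have "riesz_abs E x .= x" by (intro weak_le_antisym) simp_all
  then show ?thesis by (simp add: eq_is_equal)
qed

text \<open>The choice \<open>x = |x| - (|x| - x)\<close> rests only on \<open>0 \<le> |x|\<close>
  and \<open>x \<le> |x|\<close>.\<close>

lemma difference_of_nonneg:
  assumes "x \<in> carrier E"
  obtains a b where "a \<in> carrier E" "b \<in> carrier E" "vzero E \<sqsubseteq> a" "vzero E \<sqsubseteq> b" "x = a \<boxminus> b"
proof (rule that)
  let ?a = "riesz_abs E x"
  show "x = ?a \<boxminus> (?a \<boxminus> x)" using assms by simp
  show "vzero E \<sqsubseteq> ?a \<boxminus> x" "vzero E \<sqsubseteq> ?a" "?a \<in> carrier E" "?a \<boxminus> x \<in> carrier E"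
    using assms by (simp_all add: abs_nonneg vminus_nonneg_iff le_abs)
qed

text \<open>The summands are \<open>u = z \<sqinter> x\<close> and \<open>v = z - u\<close>. Since
  \<open>z - y\<close> lies below both \<open>z\<close> and \<open>x\<close>, it lies below
  \<open>u\<close>, that is, \<open>v \<le> y\<close>.\<close>

lemma riesz_decomposition:
  assumes "vzero E \<sqsubseteq> x" "vzero E \<sqsubseteq> y" "vzero E \<sqsubseteq> z" "z \<sqsubseteq> x \<boxplus> y"
    and [simp]: "x \<in> carrier E" "y \<in> carrier E" "z \<in> carrier E"
  obtains u v where "u \<in> carrier E" "v \<in> carrier E" "vzero E \<sqsubseteq> u" "u \<sqsubseteq> x"
    "vzero E \<sqsubseteq> v" "v \<sqsubseteq> y" "z = u \<boxplus> v"
proof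
  let ?u = "z \<sqinter> x"
  show "?u \<in> carrier E" "z \<boxminus> ?u \<in> carrier E" by simp_all
  show "vzero E \<sqsubseteq> ?u" using assms by (simp add: meet_le)
  show "?u \<sqsubseteq> x" by (simp add: meet_right)
  show "vzero E \<sqsubseteq> z \<boxminus> ?u" by (simp add: vminus_nonneg_iff meet_left)
  have "z \<boxminus> y \<sqsubseteq> ?u"
    using assms by (intro meet_le) (simp_all add: vminus_le_self vminus_le_iff)
  then show "z \<boxminus> ?u \<sqsubseteq> y"
    by (simp add: vminus_le_iff vadd_commute)
  show "z = ?u \<boxplus> (z \<boxminus> ?u)"
    by (simp add: vadd_commute[of _ "z \<boxminus> _"])
qed

section \<open>The order dual\<close>

text \<open>The order interval \<open>[0, x]\<close>, over which the supremum in the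
  Riesz--Kantorovich formula is taken.\<close>

definition positive_interval :: "'a \<Rightarrow> 'a set" where
  "positive_interval x = {y \<in> carrier E. vzero E \<sqsubseteq> y \<and> y \<sqsubseteq> x}"

end

lemma order_dual_simps [simp]:
  "le (order_dual E) f g \<longleftrightarrow> (\<forall>x\<in>carrier E. le E (vzero E) x \<longrightarrow> f x \<le> g x)"
  "eq (order_dual E) = (=)"
  "vadd (order_dual E) f g = (\<lambda>x\<in>carrier E. f x + g x)"
  "vzero (order_dual E) = (\<lambda>x\<in>carrier E. 0)"
  "vscale (order_dual E) c f = (\<lambda>x\<in>carrier E. c * f x)"
  by (simp_all add: order_dual_def)

lemma order_dual_carrier_iff:
  "f \<in> carrier (order_dual E) \<longleftrightarrow>
     f \<in> extensional (carrier E) \<and> riesz_linear E real_riesz f \<and> order_bounded E f"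
  by (simp add: order_dual_def)

lemma riesz_linear_real_iff:
  "riesz_linear E real_riesz f \<longleftrightarrow>
     (\<forall>x\<in>carrier E. \<forall>y\<in>carrier E. f (x \<boxplus>\<^bsub>E\<^esub> y) = f x + f y) \<and>
     (\<forall>c. \<forall>x\<in>carrier E. f (c \<cdot>\<^bsub>E\<^esub> x) = c * f x)"
  by (auto simp: riesz_linear_def)

lemma order_dual_ext:
  "f \<in> carrier (order_dual E) \<Longrightarrow> g \<in> carrier (order_dual E) \<Longrightarrow>
    (\<And>x. x \<in> carrier E \<Longrightarrow> f x = g x) \<Longrightarrow> f = g"
  by (auto simp: order_dual_carrier_iff intro: extensionalityI)

lemma order_dual_apply:
  assumes "f \<in> carrier (order_dual E)"
  shows "\<lbrakk>x \<in> carrier E; y \<in> carrier E\<rbrakk> \<Longrightarrow> f (x \<boxplus>\<^bsub>E\<^esub> y) = f x + f y"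
    "x \<in> carrier E \<Longrightarrow> f (c \<cdot>\<^bsub>E\<^esub> x) = c * f x"
  using assms by (auto simp: order_dual_carrier_iff riesz_linear_real_iff)

context riesz
begin

section \<open>Domination, order boundedness and extension from the positive cone\<close>

lemma linear_mono:
  assumes "riesz_linear E real_riesz p" "\<And>t. t \<in> carrier E \<Longrightarrow> vzero E \<sqsubseteq> t \<Longrightarrow> 0 \<le> p t"
    and "x \<sqsubseteq> y" and [simp]: "x \<in> carrier E" "y \<in> carrier E"
  shows "p x \<le> p y"
proof -
  have "0 \<le> p (y \<boxminus> x)" using assms by (simp add: vminus_nonneg_iff)
  then show ?thesis using assms(1) by (simp add: riesz_linear_real_iff)
qed

text \<open>If \<open>a \<le> x \<le> b\<close>, then \<open>x\<close> and \<open>-x\<close> are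
  both at most \<open>|b| + |a|\<close>, so \<open>|x| \<le> |b| + |a|\<close>. At
  \<open>t \<ge> 0\<close> the hypothesis reads \<open>|f t| \<le> p t\<close>; hence
  \<open>p\<close> is positive and monotone, and its value at \<open>|b| + |a|\<close> bounds
  \<open>|f x|\<close>.\<close>

lemma dominated_order_bounded:
  assumes f: "riesz_linear E real_riesz f" and p: "riesz_linear E real_riesz p"
    and fp: "\<And>t. t \<in> carrier E \<Longrightarrow> \<bar>f t\<bar> \<le> p (riesz_abs E t)"
  shows "order_bounded E f"
  unfolding order_bounded_def
proof (intro ballI exI allI impI)
  fix a b x assume ab [simp]: "a \<in> carrier E" "b \<in> carrier E" "x \<in> carrier E" and x: "a \<sqsubseteq> x \<and> x \<sqsubseteq> b"
  have pos: "0 \<le> p t" if "t \<in> carrier E" "vzero E \<sqsubseteq> t" for t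
    using fp[OF that(1)] that by (simp add: abs_of_nonneg)
  have "x \<sqsubseteq> b \<boxplus> riesz_abs E a"
    using x abs_nonneg vadd_mono_both[of x b "vzero E" "riesz_abs E a"] by simp
  then have "x \<sqsubseteq> riesz_abs E b \<boxplus> riesz_abs E a"
    using vadd_mono[of b "riesz_abs E b" "riesz_abs E a"] le_abs le_trans[of x] by simp
  moreover have "(-1) \<cdot> x \<sqsubseteq> riesz_abs E a"
    using vneg_antimono[of a x] x neg_le_abs[of a] le_trans[of "(-1) \<cdot> x"] by simp
  then have "(-1) \<cdot> x \<sqsubseteq> riesz_abs E b \<boxplus> riesz_abs E a"
    using vadd_mono_both[of "vzero E" "riesz_abs E b" "(-1) \<cdot> x" "riesz_abs E a"] abs_nonneg by simp
  ultimately have "riesz_abs E x \<sqsubseteq> riesz_abs E b \<boxplus> riesz_abs E a"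
    by (simp add: riesz_abs_def[of E x] join_le)
  then have "p (riesz_abs E x) \<le> p (riesz_abs E b \<boxplus> riesz_abs E a)"
    using pos by (intro linear_mono[OF p]) simp_all
  then show "\<bar>f x\<bar> \<le> p (riesz_abs E b \<boxplus> riesz_abs E a)"
    using fp[of x] by simp
qed

lemma positive_linear_abs_le:
  assumes p: "riesz_linear E real_riesz p"
    and pos: "\<And>t. t \<in> carrier E \<Longrightarrow> vzero E \<sqsubseteq> t \<Longrightarrow> 0 \<le> p t" and [simp]: "t \<in> carrier E"
  shows "\<bar>p t\<bar> \<le> p (riesz_abs E t)"
proof -
  have "p t \<le> p (riesz_abs E t)" "p ((-1) \<cdot> t) \<le> p (riesz_abs E t)"
    using pos by (intro linear_mono[OF p]; simp add: le_abs neg_le_abs)+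
  then show ?thesis using p by (simp add: riesz_linear_real_iff)
qed

text \<open>Both \<open>g - f\<close> and \<open>g + f\<close> are positive. Adding their bounds at
  \<open>|t|\<close> and using \<open>2 |f t| \<le> |g t - f t| + |g t + f t|\<close> gives the
  claim.\<close>

lemma dual_abs_le:
  assumes f: "f \<in> carrier (order_dual E)" and g: "g \<in> carrier (order_dual E)"
    and fg: "\<And>t. t \<in> carrier E \<Longrightarrow> vzero E \<sqsubseteq> t \<Longrightarrow> \<bar>f t\<bar> \<le> g t" and "t \<in> carrier E"
  shows "\<bar>f t\<bar> \<le> g (riesz_abs E t)"
proof -
  have lin: "riesz_linear E real_riesz (\<lambda>t. g t - f t)" "riesz_linear E real_riesz (\<lambda>t. g t + f t)"
    using f g by (simp_all add: order_dual_carrier_iff riesz_linear_real_iff algebra_simps)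
  have "\<bar>g t - f t\<bar> \<le> g (riesz_abs E t) - f (riesz_abs E t)"
    by (rule positive_linear_abs_le[OF lin(1)]) (use fg assms(4) abs_le_D1 in force)+
  moreover have "\<bar>g t + f t\<bar> \<le> g (riesz_abs E t) + f (riesz_abs E t)"
    by (rule positive_linear_abs_le[OF lin(2)]) (use fg assms(4) abs_le_D2 in force)+
  ultimately show ?thesis by linarith
qed

text \<open>The extension is \<open>T x = p a - p b\<close> for any decomposition \<open>x = a - b\<close> with \<open>a, b \<ge> 0\<close>.\<close>

lemma cone_extension:
  assumes add: "\<And>x y. \<lbrakk>x \<in> carrier E; y \<in> carrier E; vzero E \<sqsubseteq> x; vzero E \<sqsubseteq> y\<rbrakk> \<Longrightarrow> p (x \<boxplus> y) = p x + p y"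
    and scale: "\<And>c x. \<lbrakk>x \<in> carrier E; vzero E \<sqsubseteq> x; 0 \<le> c\<rbrakk> \<Longrightarrow> p (c \<cdot> x) = c * p x"
    and pos: "\<And>x. \<lbrakk>x \<in> carrier E; vzero E \<sqsubseteq> x\<rbrakk> \<Longrightarrow> 0 \<le> p x"
  obtains T where "T \<in> carrier (order_dual E)"
    "\<And>x. \<lbrakk>x \<in> carrier E; vzero E \<sqsubseteq> x\<rbrakk> \<Longrightarrow> T x = p x"
proof
  let ?a = "riesz_abs E"
  define T where "T = (\<lambda>x\<in>carrier E. p (?a x) - p (?a x \<boxminus> x))"
  have T: "T (a \<boxminus> b) = p a - p b"
    if [simp]: "a \<in> carrier E" "b \<in> carrier E" and ab: "vzero E \<sqsubseteq> a" "vzero E \<sqsubseteq> b" for a b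
  proof -
    let ?x = "a \<boxminus> b"
    have nn: "vzero E \<sqsubseteq> ?a ?x" "vzero E \<sqsubseteq> ?a ?x \<boxminus> ?x"
      by (simp_all add: abs_nonneg vminus_nonneg_iff le_abs)
    \<comment> \<open>Two decompositions of the same element, compared as sums of positive elements,
      where \<open>p\<close> is additive.\<close>
    have "?a ?x \<boxplus> b = a \<boxplus> (?a ?x \<boxminus> ?x)"
      by (simp add: vadd_left_commute[of a])
    then have "p (?a ?x) + p b = p a + p (?a ?x \<boxminus> ?x)"
      using nn ab add by (metis abs_closed that vadd_closed vscale_closed)
    then show ?thesis by (simp add: T_def)
  qed
  \<comment> \<open>The decomposition is \<open>x = x - 0\<close>; homogeneity with the factor 0
    gives \<open>p 0 = 0\<close>.\<close>
  show Tp: "T x = p x" if "x \<in> carrier E" "vzero E \<sqsubseteq> x" for x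
    using T[of x "vzero E"] that scale[of "vzero E" 0] by simp
  have Tadd: "T (x \<boxplus> y) = T x + T y" if xy: "x \<in> carrier E" "y \<in> carrier E" for x y
  proof -
    obtain a b where ab [simp]: "a \<in> carrier E" "b \<in> carrier E" "vzero E \<sqsubseteq> a" "vzero E \<sqsubseteq> b" and x: "x = a \<boxminus> b"
      using difference_of_nonneg[OF xy(1)] .
    obtain c d where cd [simp]: "c \<in> carrier E" "d \<in> carrier E" "vzero E \<sqsubseteq> c" "vzero E \<sqsubseteq> d" and y: "y = c \<boxminus> d"
      using difference_of_nonneg[OF xy(2)] .
    have "x \<boxplus> y = (a \<boxplus> c) \<boxminus> (b \<boxplus> d)" by (simp add: x y vscale_add_right vadd_ac)
    then show ?thesis by (simp only: T vadd_closed vadd_nonneg ab cd add) (simp add: x y T)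
  qed
  have Tscale: "T (c \<cdot> x) = c * T x" if xc: "x \<in> carrier E" for c x
  proof -
    obtain a b where ab [simp]: "a \<in> carrier E" "b \<in> carrier E" "vzero E \<sqsubseteq> a" "vzero E \<sqsubseteq> b" and x: "x = a \<boxminus> b"
      using difference_of_nonneg[OF xc] .
    show ?thesis
    proof (cases "0 \<le> c")
      case True
      have "c \<cdot> x = c \<cdot> a \<boxminus> c \<cdot> b" by (simp add: x vscale_add_right vscale_vscale)
      with True show ?thesis by (simp add: T x vscale_nonneg scale algebra_simps)
    next
      case False
      \<comment> \<open>For negative \<open>c\<close> the two parts change places, so that both are
        multiplied by the positive scalar \<open>-c\<close>.\<close>
      have "c \<cdot> x = (-c) \<cdot> b \<boxminus> (-c) \<cdot> a" by (simp add: x vscale_add_right vscale_vscale vadd_commute)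
      with False show ?thesis by (simp add: T vscale_nonneg scale) (simp add: T x algebra_simps)
    qed
  qed
  have lin: "riesz_linear E real_riesz T"
    using Tadd Tscale by (simp add: riesz_linear_real_iff)
  moreover have "order_bounded E T"
    by (rule dominated_order_bounded[OF lin lin], rule positive_linear_abs_le[OF lin])
       (simp_all add: Tp pos)
  ultimately show "T \<in> carrier (order_dual E)"
    by (simp add: order_dual_carrier_iff T_def)
qed

section \<open>The positive part of a functional\<close>

lemma bdd_above_positive_interval:
  assumes "f \<in> carrier (order_dual E)" "x \<in> carrier E"
  shows "bdd_above (f ` positive_interval x)"
proof -
  obtain M where "\<forall>y\<in>carrier E. vzero E \<sqsubseteq> y \<and> y \<sqsubseteq> x \<longrightarrow> \<bar>f y\<bar> \<le> M"
    using assms vzero_closed unfolding order_dual_carrier_iff order_bounded_def by metis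
  then show ?thesis
    by (intro bdd_aboveI[of _ M]) (auto simp: positive_interval_def abs_le_iff)
qed

text \<open>The Riesz--Kantorovich formula for the positive part. On the cone the supremum is
  subadditive because an element of \<open>[0, x + y]\<close> splits into elements of
  \<open>[0, x]\<close> and \<open>[0, y]\<close>, and superadditive because such elements add up to
  one of \<open>[0, x + y]\<close>; \<open>cone_extension\<close> does the rest.\<close>

lemma positive_part_exists:
  assumes f: "f \<in> carrier (order_dual E)"
  obtains T where "T \<in> carrier (order_dual E)"
    "\<And>x. \<lbrakk>x \<in> carrier E; vzero E \<sqsubseteq> x\<rbrakk> \<Longrightarrow> T x = (SUP y\<in>positive_interval x. f y)"
proof -
  let ?p = "\<lambda>x. SUP y\<in>positive_interval x. f y"
  note fsimps [simp] = order_dual_apply[OF f]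
  have upper: "f y \<le> ?p x" if "y \<in> positive_interval x" "x \<in> carrier E" for x y
    using cSUP_upper[OF that(1) bdd_above_positive_interval[OF f that(2)]] .
  have zero_mem: "vzero E \<in> positive_interval x" if "vzero E \<sqsubseteq> x" for x
    using that by (simp add: positive_interval_def)
  have f0: "f (vzero E) = 0" using fsimps(2)[of "vzero E" 0] by (simp del: fsimps)
  have pos: "0 \<le> ?p x" if "x \<in> carrier E" "vzero E \<sqsubseteq> x" for x
    using upper[OF zero_mem[OF that(2)] that(1)] f0 by simp
  have least: "?p x \<le> M" if "vzero E \<sqsubseteq> x" "\<And>y. y \<in> positive_interval x \<Longrightarrow> f y \<le> M" for x M
    using zero_mem[OF that(1)] that(2) by (intro cSUP_least) auto
  have add: "?p (x \<boxplus> y) = ?p x + ?p y"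
    if xy [simp]: "x \<in> carrier E" "y \<in> carrier E" "vzero E \<sqsubseteq> x" "vzero E \<sqsubseteq> y" for x y
  proof (rule antisym)
    show "?p (x \<boxplus> y) \<le> ?p x + ?p y"
    proof (rule least)
      fix z assume "z \<in> positive_interval (x \<boxplus> y)"
      then have z: "vzero E \<sqsubseteq> z" "z \<sqsubseteq> x \<boxplus> y" "z \<in> carrier E"
        by (simp_all add: positive_interval_def)
      obtain u v where uv [simp]: "u \<in> carrier E" "v \<in> carrier E" "vzero E \<sqsubseteq> u" "u \<sqsubseteq> x"
          "vzero E \<sqsubseteq> v" "v \<sqsubseteq> y" and zuv: "z = u \<boxplus> v"
        using riesz_decomposition[OF xy(3,4) z(1,2) xy(1,2) z(3)] .
      have "f u \<le> ?p x" "f v \<le> ?p y" by (intro upper; simp add: positive_interval_def)+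
      then show "f z \<le> ?p x + ?p y" by (simp add: zuv)
    qed (simp add: vadd_nonneg)
    have "f u + f v \<le> ?p (x \<boxplus> y)" if "u \<in> positive_interval x" "v \<in> positive_interval y" for u v
    proof -
      have "f (u \<boxplus> v) \<le> ?p (x \<boxplus> y)"
        using that by (intro upper) (auto simp: positive_interval_def vadd_nonneg vadd_mono_both)
      then show ?thesis using that by (simp add: positive_interval_def)
    qed
    \<comment> \<open>The suprema are taken one variable at a time, first over \<open>u\<close> with
      \<open>v\<close> fixed, then over \<open>v\<close>.\<close>
    then have "f u \<le> ?p (x \<boxplus> y) - f v" if "u \<in> positive_interval x" "v \<in> positive_interval y" for u v
      using that by (simp add: le_diff_eq)
    then have "?p x \<le> ?p (x \<boxplus> y) - f v" if "v \<in> positive_interval y" for v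
      using that by (intro least) simp_all
    then have "f v \<le> ?p (x \<boxplus> y) - ?p x" if "v \<in> positive_interval y" for v
      using that by fastforce
    then have "?p y \<le> ?p (x \<boxplus> y) - ?p x" by (intro least) simp_all
    then show "?p x + ?p y \<le> ?p (x \<boxplus> y)" by simp
  qed
  have scale_le: "c * ?p x \<le> ?p (c \<cdot> x)" if [simp]: "x \<in> carrier E" "vzero E \<sqsubseteq> x" and c: "0 < c" for c x
  proof -
    have "f y \<le> ?p (c \<cdot> x) / c" if "y \<in> positive_interval x" for y
    proof -
      have "f (c \<cdot> y) \<le> ?p (c \<cdot> x)"
        using that c by (intro upper) (auto simp: positive_interval_def vscale_nonneg vscale_mono)
      then show ?thesis using that c by (simp add: positive_interval_def field_simps)
    qed
    then have "?p x \<le> ?p (c \<cdot> x) / c" by (intro least) simp_all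
    then show ?thesis using c by (simp add: field_simps)
  qed
  have scale: "?p (c \<cdot> x) = c * ?p x" if [simp]: "x \<in> carrier E" "vzero E \<sqsubseteq> x" and c: "0 \<le> c" for c x
  proof (cases "c = 0")
    case True
    have "f y \<le> 0" if "y \<in> positive_interval (vzero E)" for y
    proof -
      have "y .= vzero E" using that by (intro weak_le_antisym) (auto simp: positive_interval_def)
      then show ?thesis by (simp add: eq_is_equal f0)
    qed
    then have "?p (vzero E) \<le> 0" by (intro least) simp_all
    with True show ?thesis using pos[of "vzero E"] by simp
  next
    case False
    with c have c: "0 < c" by simp
    \<comment> \<open>The reverse inequality is \<open>scale_le\<close> for the factor
      \<open>1 / c\<close> at the point \<open>c \<cdot> x\<close>.\<close>
    have "(1 / c) * ?p (c \<cdot> x) \<le> ?p ((1 / c) \<cdot> c \<cdot> x)"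
      using c by (intro scale_le) (simp_all add: vscale_nonneg)
    then have "?p (c \<cdot> x) \<le> c * ?p x" using c by (simp add: vscale_vscale field_simps)
    with scale_le[of x c] c show ?thesis by simp
  qed
  show thesis
    using cone_extension[of ?p, OF add scale pos] that by blast
qed

section \<open>Linear and lattice structure of the order dual\<close>

lemma dual_vadd_closed:
  assumes "f \<in> carrier (order_dual E)" "g \<in> carrier (order_dual E)"
  shows "(\<lambda>x\<in>carrier E. f x + g x) \<in> carrier (order_dual E)"
  unfolding order_dual_carrier_iff
proof (intro conjI)
  show "riesz_linear E real_riesz (\<lambda>x\<in>carrier E. f x + g x)"
    using assms by (simp add: riesz_linear_real_iff order_dual_carrier_iff algebra_simps)
  show "order_bounded E (\<lambda>x\<in>carrier E. f x + g x)"
    unfolding order_bounded_def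
  proof (intro ballI)
    fix a b assume "a \<in> carrier E" "b \<in> carrier E"
    then obtain M N where
      "\<forall>x\<in>carrier E. a \<sqsubseteq> x \<and> x \<sqsubseteq> b \<longrightarrow> \<bar>f x\<bar> \<le> M" "\<forall>x\<in>carrier E. a \<sqsubseteq> x \<and> x \<sqsubseteq> b \<longrightarrow> \<bar>g x\<bar> \<le> N"
      using assms unfolding order_dual_carrier_iff order_bounded_def by metis
    then show "\<exists>M. \<forall>x\<in>carrier E. a \<sqsubseteq> x \<and> x \<sqsubseteq> b \<longrightarrow> \<bar>(\<lambda>x\<in>carrier E. f x + g x) x\<bar> \<le> M"
      by (intro exI[of _ "M + N"]) (auto intro: order_trans[OF abs_triangle_ineq] add_mono)
  qed
qed simp

lemma dual_vscale_closed:
  assumes "f \<in> carrier (order_dual E)"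
  shows "(\<lambda>x\<in>carrier E. c * f x) \<in> carrier (order_dual E)"
  unfolding order_dual_carrier_iff
proof (intro conjI)
  show "riesz_linear E real_riesz (\<lambda>x\<in>carrier E. c * f x)"
    using assms by (simp add: riesz_linear_real_iff order_dual_carrier_iff algebra_simps)
  show "order_bounded E (\<lambda>x\<in>carrier E. c * f x)"
    unfolding order_bounded_def
  proof (intro ballI)
    fix a b assume "a \<in> carrier E" "b \<in> carrier E"
    then obtain M where "\<forall>x\<in>carrier E. a \<sqsubseteq> x \<and> x \<sqsubseteq> b \<longrightarrow> \<bar>f x\<bar> \<le> M"
      using assms unfolding order_dual_carrier_iff order_bounded_def by metis
    then show "\<exists>M. \<forall>x\<in>carrier E. a \<sqsubseteq> x \<and> x \<sqsubseteq> b \<longrightarrow> \<bar>(\<lambda>x\<in>carrier E. c * f x) x\<bar> \<le> M"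
      by (intro exI[of _ "\<bar>c\<bar> * M"]) (auto simp: abs_mult intro: mult_left_mono)
  qed
qed simp

lemma dual_vzero_closed: "(\<lambda>x\<in>carrier E. 0) \<in> carrier (order_dual E)"
  by (auto simp: order_dual_carrier_iff riesz_linear_real_iff order_bounded_def)

text \<open>The order compares functionals on the positive cone only; since positive elements span
  the space, agreement there is equality.\<close>

lemma dual_antisym:
  assumes "f \<in> carrier (order_dual E)" "g \<in> carrier (order_dual E)"
    and "f \<sqsubseteq>\<^bsub>order_dual E\<^esub> g" "g \<sqsubseteq>\<^bsub>order_dual E\<^esub> f"
  shows "f = g"
proof (rule order_dual_ext[OF assms(1,2)])
  fix x assume "x \<in> carrier E"
  from difference_of_nonneg[OF this] obtain a b where ab [simp]: "a \<in> carrier E" "b \<in> carrier E"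
    "vzero E \<sqsubseteq> a" "vzero E \<sqsubseteq> b" and x: "x = a \<boxminus> b" .
  have "f a = g a" "f b = g b" using assms(3,4) by (auto intro: antisym)
  then show "f x = g x" by (simp add: x order_dual_apply[OF assms(1)] order_dual_apply[OF assms(2)])
qed

text \<open>The join is \<open>s = g + T\<close>, where \<open>T\<close> is the positive part of
  \<open>f - g\<close>. The second conclusion is the upper estimate in
  \<open>s x = sup (f y + g (x - y))\<close> over \<open>y\<close> in \<open>[0, x]\<close>. It
  proves that \<open>s\<close> is least, and later bounds absolute values in the bidual.\<close>

lemma dual_join:
  assumes f: "f \<in> carrier (order_dual E)" and g: "g \<in> carrier (order_dual E)"
  obtains s where "least (order_dual E) s (Upper (order_dual E) {f, g})"
    "\<And>x M. \<lbrakk>x \<in> carrier E; vzero E \<sqsubseteq> x; \<And>y. y \<in> positive_interval x \<Longrightarrow> f y + g (x \<boxminus> y) \<le> M\<rbrakk> \<Longrightarrow> s x \<le> M"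
proof -
  define h where "h = (\<lambda>x\<in>carrier E. f x + (\<lambda>x\<in>carrier E. -1 * g x) x)"
  have h: "h \<in> carrier (order_dual E)"
    unfolding h_def by (intro dual_vadd_closed dual_vscale_closed f g)
  from positive_part_exists[OF h] obtain T where T: "T \<in> carrier (order_dual E)"
    and Tx: "\<And>x. \<lbrakk>x \<in> carrier E; vzero E \<sqsubseteq> x\<rbrakk> \<Longrightarrow> T x = (SUP y\<in>positive_interval x. h y)"
    by blast
  let ?s = "\<lambda>x\<in>carrier E. g x + T x"
  have s: "?s \<in> carrier (order_dual E)" by (intro dual_vadd_closed g T)
  have hx: "h x = f x - g x" if "x \<in> carrier E" for x using that by (simp add: h_def)
  have bound: "?s x \<le> M"
    if [simp]: "x \<in> carrier E" "vzero E \<sqsubseteq> x" and M: "\<And>y. y \<in> positive_interval x \<Longrightarrow> f y + g (x \<boxminus> y) \<le> M" for x M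
  proof -
    have "T x \<le> M - g x"
      unfolding Tx[OF that(1,2)]
    proof (rule cSUP_least)
      show "positive_interval x \<noteq> {}" by (auto simp: positive_interval_def intro!: exI[of _ x])
      fix y assume y: "y \<in> positive_interval x"
      then show "h y \<le> M - g x"
        using M[OF y] by (simp add: hx positive_interval_def order_dual_apply[OF g])
    qed
    then show ?thesis by simp
  qed
  have upper: "h y \<le> T x" if "x \<in> carrier E" "y \<in> positive_interval x" "vzero E \<sqsubseteq> x" for x y
    unfolding Tx[OF that(1,3)] by (rule cSUP_upper[OF that(2) bdd_above_positive_interval[OF h that(1)]])
  have "least (order_dual E) ?s (Upper (order_dual E) {f, g})"
    unfolding least_def
  proof (intro conjI ballI)
    \<comment> \<open>Two points of \<open>[0, x]\<close> suffice in the supremum defining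
      \<open>T x\<close>: \<open>y = x\<close> gives \<open>f \<le> s\<close>, and
      \<open>y = 0\<close> gives \<open>g \<le> s\<close>.\<close>
    have "f x \<le> ?s x" if "x \<in> carrier E" "vzero E \<sqsubseteq> x" for x
      using upper[of x x] that by (simp add: positive_interval_def hx)
    moreover have "g x \<le> ?s x" if "x \<in> carrier E" "vzero E \<sqsubseteq> x" for x
      using upper[of x "vzero E"] that order_dual_apply(2)[OF h, of "vzero E" 0]
      by (simp add: positive_interval_def)
    ultimately show "?s \<in> Upper (order_dual E) {f, g}"
      using s by (auto simp: Upper_def)
    fix u assume "u \<in> Upper (order_dual E) {f, g}"
    then have u: "u \<in> carrier (order_dual E)"
      and fu: "\<And>x. x \<in> carrier E \<Longrightarrow> vzero E \<sqsubseteq> x \<Longrightarrow> f x \<le> u x"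
      and gu: "\<And>x. x \<in> carrier E \<Longrightarrow> vzero E \<sqsubseteq> x \<Longrightarrow> g x \<le> u x"
      using f g by (auto simp: Upper_def)
    show "?s \<sqsubseteq>\<^bsub>order_dual E\<^esub> u"
      unfolding order_dual_simps
    proof (intro ballI impI bound)
      fix x y assume x: "x \<in> carrier E" "vzero E \<sqsubseteq> x" and y: "y \<in> positive_interval x"
      then have "f y \<le> u y" "g (x \<boxminus> y) \<le> u (x \<boxminus> y)"
        by (auto intro!: fu gu simp: positive_interval_def vminus_nonneg_iff)
      then show "f y + g (x \<boxminus> y) \<le> u x"
        using x y by (simp add: order_dual_apply[OF u] positive_interval_def)
    qed
  qed (auto simp: Upper_def)
  with bound show thesis using that by blast
qed

text \<open>Infima come from suprema by negation: the meet of \<open>f\<close> and \<open>g\<close>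
  is the negative of the join of \<open>-f\<close> and \<open>-g\<close>.\<close>

lemma riesz_space_order_dual: "riesz_space (order_dual E)"
proof -
  interpret partial_order "order_dual E"
    by unfold_locales (auto intro: dual_antisym order_trans)
  note closed = dual_vadd_closed dual_vscale_closed dual_vzero_closed
  have inf: "\<exists>s. greatest (order_dual E) s (Lower (order_dual E) {f, g})"
    if fg: "f \<in> carrier (order_dual E)" "g \<in> carrier (order_dual E)" for f g
  proof -
    let ?n = "\<lambda>f. \<lambda>x\<in>carrier E. -1 * f x"
    obtain s where s: "least (order_dual E) s (Upper (order_dual E) {?n f, ?n g})"
      using dual_join[of "?n f" "?n g"] fg by (metis dual_vscale_closed)
    have "greatest (order_dual E) (?n s) (Lower (order_dual E) {f, g})"
      unfolding greatest_def
    proof (intro conjI ballI)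
      have sc: "s \<in> carrier (order_dual E)" using s by (rule least_closed)
      show "?n s \<in> Lower (order_dual E) {f, g}"
      proof -
        have "s \<in> Upper (order_dual E) {?n f, ?n g}" using s by (simp add: least_def)
        then have "?n f \<sqsubseteq>\<^bsub>order_dual E\<^esub> s" "?n g \<sqsubseteq>\<^bsub>order_dual E\<^esub> s"
          using dual_vscale_closed[OF fg(1), of "-1"] dual_vscale_closed[OF fg(2), of "-1"]
          unfolding Upper_def by blast+
        then show ?thesis
          using dual_vscale_closed[OF sc, of "-1"]
          by (auto simp: Lower_def minus_le_iff)
      qed
      fix u assume u: "u \<in> Lower (order_dual E) {f, g}"
      then have "?n u \<in> Upper (order_dual E) {?n f, ?n g}"
        using fg dual_vscale_closed[of u "-1"] by (auto simp: Lower_def Upper_def)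
      with s have "s \<sqsubseteq>\<^bsub>order_dual E\<^esub> ?n u" by (rule least_le)
      then show "u \<sqsubseteq>\<^bsub>order_dual E\<^esub> ?n s" by auto
    qed (auto simp: Lower_def)
    then show ?thesis by blast
  qed
  have "lattice (order_dual E)"
    by unfold_locales (use dual_join inf in metis)+
  then show ?thesis
  proof (intro riesz_space.intro riesz_space_axioms.intro, goal_cases)
    \<comment> \<open>Cases 13 and 14 are the monotonicity of addition and of multiplication by
      nonnegative scalars.\<close>
    case (13 f g h)
    then show ?case by auto
  next
    case (14 f g c)
    then show ?case by (auto intro: mult_left_mono)
  qed (simp_all add: closed del: restrict_apply,
      auto simp: fun_eq_iff extensional_def order_dual_carrier_iff algebra_simps)
qed

end

lemma riesz_order_dual: "riesz_space E \<Longrightarrow> riesz (order_dual E)"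
  by (simp add: riesz.intro riesz.riesz_space_order_dual)

section \<open>Functionals that commute with the absolute value\<close>

lemma riesz_hom_abs:
  assumes "riesz_hom E real_riesz f" "riesz_space E" "x \<in> carrier E"
  shows "f (riesz_abs E x) = \<bar>f x\<bar>"
proof -
  interpret riesz E using assms(2) by (rule riesz.intro)
  have "f (riesz_abs E x) = riesz_abs real_riesz (f x)"
    using assms by (simp add: riesz_hom_def riesz_abs_def riesz_linear_real_iff)
  then show ?thesis by (simp add: riesz_abs_real_riesz)
qed

context riesz
begin

text \<open>The vector \<open>h t \<cdot> s - h s \<cdot> t\<close> lies in the kernel of
  \<open>h\<close>, and domination forces \<open>f\<close> to vanish on that kernel.\<close>

lemma dominated_proportional:
  assumes f: "riesz_linear E real_riesz f" and h: "riesz_linear E real_riesz h"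
    and dom: "\<And>t. t \<in> carrier E \<Longrightarrow> \<bar>f t\<bar> \<le> \<bar>h t\<bar>"
    and [simp]: "s \<in> carrier E" "t \<in> carrier E"
  shows "f s * h t = f t * h s"
proof -
  let ?u = "h t \<cdot> s \<boxminus> h s \<cdot> t"
  have "h ?u = 0" using h by (simp add: riesz_linear_real_iff)
  then have "f ?u = 0" using dom[of ?u] by simp
  then show ?thesis using f by (simp add: riesz_linear_real_iff mult.commute)
qed

text \<open>Both \<open>f\<close> and \<open>g\<close> are multiples of \<open>h\<close>, hence
  proportional to each other. This will compare two slices of a form through a common bound.\<close>

lemma dominated_swap:
  assumes f: "riesz_linear E real_riesz f" and g: "riesz_linear E real_riesz g"
    and h: "riesz_linear E real_riesz h"
    and fh: "\<And>t. t \<in> carrier E \<Longrightarrow> \<bar>f t\<bar> \<le> \<bar>h t\<bar>"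
    and gh: "\<And>t. t \<in> carrier E \<Longrightarrow> \<bar>g t\<bar> \<le> \<bar>h t\<bar>"
    and s: "s \<in> carrier E" and t: "t \<in> carrier E"
  shows "f s * g t = f t * g s"
proof (cases "h s = 0")
  case True
  then show ?thesis using fh[OF s] gh[OF s] by simp
next
  case False
  have "f t = f s * h t / h s" "g t = g s * h t / h s"
    using dominated_proportional[OF f h fh s t] dominated_proportional[OF g h gh s t] False
    by (simp_all add: field_simps)
  then show ?thesis by simp
qed

text \<open>Every \<open>y\<close> in \<open>[0, p]\<close> equals \<open>c \<cdot> p\<close> with
  \<open>0 \<le> c \<le> 1\<close>, so \<open>f y - f (p - y) = (2c - 1) f p\<close> is at most
  \<open>|f p|\<close>. The estimate of \<open>dual_join\<close> for \<open>f\<close> and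
  \<open>-f\<close> therefore bounds \<open>|f|\<close> at \<open>p\<close>; the other inequality
  follows from \<open>f, -f \<le> |f|\<close> and \<open>p \<ge> 0\<close>.\<close>

lemma bidual_abs_apply:
  assumes p: "p \<in> carrier (order_dual E)"
    and pabs: "\<And>x. x \<in> carrier E \<Longrightarrow> p (riesz_abs E x) = \<bar>p x\<bar>"
    and f: "f \<in> carrier (order_bidual E)"
  shows "riesz_abs (order_bidual E) f p = \<bar>f p\<bar>"
proof (rule antisym)
  interpret D: riesz "order_dual E" by (rule riesz_order_dual) unfold_locales
  interpret DD: riesz "order_bidual E" by (rule riesz_order_dual) unfold_locales
  let ?n = "\<lambda>g\<in>carrier (order_dual E). -1 * f g"
  have n: "?n \<in> carrier (order_bidual E)" by (rule D.dual_vscale_closed[OF f])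
  have lin: "riesz_linear E real_riesz p" using p by (simp add: order_dual_carrier_iff)
  have ppos: "0 \<le> p t" if "t \<in> carrier E" "vzero E \<sqsubseteq> t" for t
    using pabs[OF that(1)] that by (simp add: abs_of_nonneg)
  show "\<bar>f p\<bar> \<le> riesz_abs (order_bidual E) f p"
    using DD.le_abs[OF f] DD.neg_le_abs[OF f] p ppos by (auto simp: abs_le_iff)
  obtain s where s: "least (order_bidual E) s (Upper (order_bidual E) {f, ?n})"
    and bound: "\<And>x M. \<lbrakk>x \<in> carrier (order_dual E); vzero (order_dual E) \<sqsubseteq>\<^bsub>order_dual E\<^esub> x;
      \<And>y. y \<in> D.positive_interval x \<Longrightarrow> f y + ?n (D.vminus x y) \<le> M\<rbrakk> \<Longrightarrow> s x \<le> M"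
    using D.dual_join[OF f n] by blast
  have "riesz_abs (order_bidual E) f = s"
    unfolding riesz_abs_def order_dual_simps
    by (rule DD.joinI[OF _ f n]) (rule DD.least_unique[OF _ s])
  moreover have "s p \<le> \<bar>f p\<bar>"
  proof (rule bound[OF p])
    show "vzero (order_dual E) \<sqsubseteq>\<^bsub>order_dual E\<^esub> p" using ppos by simp
    fix y assume "y \<in> D.positive_interval p"
    then have y: "y \<in> carrier (order_dual E)"
      and y0: "\<And>t. t \<in> carrier E \<Longrightarrow> vzero E \<sqsubseteq> t \<Longrightarrow> 0 \<le> y t"
      and yp: "\<And>t. t \<in> carrier E \<Longrightarrow> vzero E \<sqsubseteq> t \<Longrightarrow> y t \<le> p t"
      by (auto simp: D.positive_interval_def)
    have ylin: "riesz_linear E real_riesz y" using y by (simp add: order_dual_carrier_iff)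
    \<comment> \<open>The bound on the positive cone becomes a bound for all \<open>t\<close>,
      because \<open>p |t| = |p t|\<close>; so \<open>y\<close> vanishes on the kernel of
      \<open>p\<close>.\<close>
    have yabs: "\<bar>y t\<bar> \<le> \<bar>p t\<bar>" if "t \<in> carrier E" for t
      using dual_abs_le[OF y p _ that] y0 yp pabs[OF that] by simp
    \<comment> \<open>If \<open>p t \<noteq> 0\<close> for some \<open>t\<close>, the factor is read
      off at \<open>|t|\<close>, where \<open>p\<close> is strictly positive. If \<open>p\<close>
      vanishes, so does \<open>y\<close>, and \<open>c = 0\<close> works.\<close>
    obtain c where c: "0 \<le> c" "c \<le> 1" and yc: "y = c \<cdot>\<^bsub>order_dual E\<^esub> p"
    proof (cases "\<exists>t\<in>carrier E. p t \<noteq> 0")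
      case True
      then obtain t where t: "t \<in> carrier E" "p t \<noteq> 0" by blast
      let ?t = "riesz_abs E t"
      have pt: "0 < p ?t" and [simp]: "?t \<in> carrier E" using t pabs by simp_all
      show thesis
      proof (rule that[of "y ?t / p ?t"])
        show "0 \<le> y ?t / p ?t" "y ?t / p ?t \<le> 1"
          using pt y0[of ?t] yp[of ?t] t by (simp_all add: abs_nonneg)
        show "y = (y ?t / p ?t) \<cdot>\<^bsub>order_dual E\<^esub> p"
        proof (rule order_dual_ext[OF y D.vscale_closed[OF p]])
          fix x assume x: "x \<in> carrier E"
          show "y x = ((y ?t / p ?t) \<cdot>\<^bsub>order_dual E\<^esub> p) x"
            using dominated_proportional[OF ylin lin yabs x, of ?t] pt x by (simp add: field_simps)
        qed
      qed
    next
      case False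
      have "y = 0 \<cdot>\<^bsub>order_dual E\<^esub> p"
        by (rule order_dual_ext[OF y D.vscale_closed[OF p]]) (use False yabs in fastforce)
      then show thesis using that[of 0] by simp
    qed
    have "f y = c * f p" unfolding yc by (rule order_dual_apply(2)[OF f p])
    moreover have "f (D.vminus p y) = f p - f y"
      by (simp only: order_dual_apply[OF f] p y D.vscale_closed)
    moreover have "?n (D.vminus p y) = - f (D.vminus p y)"
      using D.vadd_closed[OF p D.vscale_closed[OF y]] by (simp only: restrict_apply) simp
    ultimately have "f y + ?n (D.vminus p y) = (2 * c - 1) * f p" by (simp only:) (simp add: algebra_simps)
    also have "\<dots> \<le> \<bar>(2 * c - 1) * f p\<bar>" by (rule abs_ge_self)
    also have "\<dots> \<le> 1 * \<bar>f p\<bar>" unfolding abs_mult using c by (intro mult_right_mono) auto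
    finally show "f y + ?n (D.vminus p y) \<le> \<bar>f p\<bar>" by simp
  qed
  ultimately show "riesz_abs (order_bidual E) f p \<le> \<bar>f p\<bar>" by simp
qed

text \<open>The hypothesis says \<open>|f| \<le> g\<close> in the order dual, so
  \<open>|u f| \<le> |u| |f| \<le> |u| g\<close>. The second bound is the first one for
  \<open>|u|\<close>, which is its own absolute value.\<close>

lemma bidual_abs_dominates:
  assumes u: "u \<in> carrier (order_bidual E)"
    and f: "f \<in> carrier (order_dual E)" and g: "g \<in> carrier (order_dual E)"
    and fg: "\<And>t. t \<in> carrier E \<Longrightarrow> vzero E \<sqsubseteq> t \<Longrightarrow> \<bar>f t\<bar> \<le> g t"
  shows "\<bar>u f\<bar> \<le> riesz_abs (order_bidual E) u g"
    and "\<bar>riesz_abs (order_bidual E) u f\<bar> \<le> riesz_abs (order_bidual E) u g"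
proof -
  interpret D: riesz "order_dual E" by (rule riesz_order_dual) unfold_locales
  interpret DD: riesz "order_bidual E" by (rule riesz_order_dual) unfold_locales
  have *: "\<bar>v f\<bar> \<le> riesz_abs (order_bidual E) v g" if v: "v \<in> carrier (order_bidual E)" for v
  proof -
    let ?v = "riesz_abs (order_bidual E) v"
    have av: "?v \<in> carrier (order_bidual E)" using v by (rule DD.abs_closed)
    have pos: "0 \<le> ?v t" if "t \<in> carrier (order_dual E)" "vzero (order_dual E) \<sqsubseteq>\<^bsub>order_dual E\<^esub> t" for t
      using DD.abs_nonneg[OF v] that by simp
    have "\<bar>v f\<bar> \<le> ?v (riesz_abs (order_dual E) f)"
      by (rule D.dual_abs_le[OF v av _ f])
         (use DD.le_abs[OF v] DD.neg_le_abs[OF v] in \<open>auto simp: abs_le_iff\<close>)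
    also have "\<dots> \<le> ?v g"
    proof (rule D.linear_mono[of ?v])
      show "riesz_linear (order_dual E) real_riesz ?v" using av by (simp add: order_dual_carrier_iff)
      show "riesz_abs (order_dual E) f \<sqsubseteq>\<^bsub>order_dual E\<^esub> g"
        unfolding riesz_abs_def[of "order_dual E"]
      proof (rule D.join_le[OF _ _ f D.vscale_closed[OF f] g])
        show "f \<sqsubseteq>\<^bsub>order_dual E\<^esub> g" "(-1) \<cdot>\<^bsub>order_dual E\<^esub> f \<sqsubseteq>\<^bsub>order_dual E\<^esub> g"
          using fg by (auto simp: abs_le_iff)
      qed
    qed (use pos D.abs_closed[OF f] g in auto)
    finally show ?thesis .
  qed
  show "\<bar>u f\<bar> \<le> riesz_abs (order_bidual E) u g" by (rule *[OF u])
  show "\<bar>riesz_abs (order_bidual E) u f\<bar> \<le> riesz_abs (order_bidual E) u g"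
    using *[OF DD.abs_closed[OF u]] DD.abs_of_nonneg[OF DD.abs_nonneg[OF u] DD.abs_closed[OF u]] by simp
qed

end

section \<open>Multilinear forms\<close>

lemma multilinear_realD:
  assumes "multilinear I E real_riesz B" "x \<in> riesz_prod I E" "i \<in> I" "u \<in> carrier (E i)"
  shows "v \<in> carrier (E i) \<Longrightarrow> B (x(i := u \<boxplus>\<^bsub>E i\<^esub> v)) = B (x(i := u)) + B (x(i := v))"
    "B (x(i := c \<cdot>\<^bsub>E i\<^esub> u)) = c * B (x(i := u))"
  using assms unfolding multilinear_def by auto

lemma multilinear_realI:
  assumes "\<And>x i u v. \<lbrakk>x \<in> riesz_prod I E; i \<in> I; u \<in> carrier (E i); v \<in> carrier (E i)\<rbrakk>
      \<Longrightarrow> B (x(i := u \<boxplus>\<^bsub>E i\<^esub> v)) = B (x(i := u)) + B (x(i := v))"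
    and "\<And>x i u c. \<lbrakk>x \<in> riesz_prod I E; i \<in> I; u \<in> carrier (E i)\<rbrakk>
      \<Longrightarrow> B (x(i := c \<cdot>\<^bsub>E i\<^esub> u)) = c * B (x(i := u))"
  shows "multilinear I E real_riesz B"
  using assms unfolding multilinear_def by auto

abbreviation abs_family :: "nat set \<Rightarrow> (nat \<Rightarrow> 'a riesz) \<Rightarrow> (nat \<Rightarrow> 'a) \<Rightarrow> nat \<Rightarrow> 'a" where
  "abs_family I E x \<equiv> \<lambda>i\<in>I. riesz_abs (E i) (x i)"

lemma riesz_prod_upd:
  "x \<in> riesz_prod I E \<Longrightarrow> t \<in> carrier (E j) \<Longrightarrow> x(j := t) \<in> riesz_prod (insert j I) E"
  by (auto simp: PiE_iff extensional_def)

lemma riesz_prod_upd_same: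
  "x \<in> riesz_prod I E \<Longrightarrow> j \<in> I \<Longrightarrow> t \<in> carrier (E j) \<Longrightarrow> x(j := t) \<in> riesz_prod I E"
  using riesz_prod_upd[of x I E t j] by (simp add: insert_absorb)

lemma abs_family_closed:
  "(\<And>i. i \<in> I \<Longrightarrow> riesz_space (E i)) \<Longrightarrow> x \<in> riesz_prod I E \<Longrightarrow> abs_family I E x \<in> riesz_prod I E"
  by (auto simp: PiE_iff riesz.abs_closed riesz.intro)

lemma abs_family_upd:
  "abs_family (insert j I) E (x(j := t)) = (abs_family I E x)(j := riesz_abs (E j) t)"
  by (auto simp: fun_eq_iff)

lemma multilinear_partial:
  assumes "multilinear (insert j I) E real_riesz B" "x \<in> riesz_prod I E" "riesz_space (E j)"
  shows "riesz_linear (E j) real_riesz (\<lambda>t. B (x(j := t)))"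
proof -
  interpret riesz "E j" using assms(3) by (rule riesz.intro)
  \<comment> \<open>The coordinate \<open>x j\<close> may lie outside \<open>E j\<close>, so
    \<open>x(j := 0)\<close> serves as base point for multilinearity.\<close>
  show ?thesis
    using multilinear_realD[OF assms(1) riesz_prod_upd[OF assms(2) vzero_closed], of j]
    by (simp add: riesz_linear_real_iff)
qed

subsection \<open>Dominated forms\<close>

text \<open>
  A form is regular if and only if it is dominated by some \<open>P\<close>. Bounding \<open>\<bar>B x\<bar>\<close> for all \<open>x\<close>, and
  not only for positive families, avoids splitting \<open>x\<close> into its \<open>2\<^sup>m\<close> signed parts.
\<close>

definition form_dominated ::
  "nat set \<Rightarrow> (nat \<Rightarrow> 'a riesz) \<Rightarrow> ((nat \<Rightarrow> 'a) \<Rightarrow> real) \<Rightarrow> ((nat \<Rightarrow> 'a) \<Rightarrow> real) \<Rightarrow> bool" where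
  "form_dominated I E P B \<longleftrightarrow>
     multilinear I E real_riesz B \<and> multilinear I E real_riesz P \<and>
     (\<forall>x\<in>riesz_prod I E. \<bar>B x\<bar> \<le> P (abs_family I E x) \<and> \<bar>P x\<bar> \<le> P (abs_family I E x))"

lemma form_dominated_refl: "form_dominated I E P B \<Longrightarrow> form_dominated I E P P"
  by (simp add: form_dominated_def)

text \<open>Restricted to the carrier because elements of the order dual are extensional.\<close>

definition form_slice ::
  "(nat \<Rightarrow> 'a riesz) \<Rightarrow> nat \<Rightarrow> ((nat \<Rightarrow> 'a) \<Rightarrow> real) \<Rightarrow> (nat \<Rightarrow> 'a) \<Rightarrow> 'a \<Rightarrow> real" where
  "form_slice E j B x = (\<lambda>t\<in>carrier (E j). B (x(j := t)))"

text \<open>The slice of \<open>B\<close> at \<open>x\<close> is dominated by the slice of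
  \<open>P\<close> at the family of absolute values of \<open>x\<close>, which makes it order
  bounded.\<close>

lemma form_slice_closed:
  assumes B: "form_dominated (insert j I) E P B" and E: "\<And>i. i \<in> insert j I \<Longrightarrow> riesz_space (E i)"
    and x: "x \<in> riesz_prod I E"
  shows "form_slice E j B x \<in> carrier (order_dual (E j))"
proof -
  interpret riesz "E j" using E by (simp add: riesz.intro)
  let ?f = "form_slice E j B x" and ?p = "form_slice E j P (abs_family I E x)"
  have ax: "abs_family I E x \<in> riesz_prod I E" using E x by (intro abs_family_closed) auto
  have "riesz_linear (E j) real_riesz ?f" "riesz_linear (E j) real_riesz ?p"
    using multilinear_partial[of j I E B x] multilinear_partial[of j I E P "abs_family I E x"] B E x ax
    by (simp_all add: form_dominated_def riesz_linear_real_iff form_slice_def)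
  moreover have "\<bar>?f t\<bar> \<le> ?p (riesz_abs (E j) t)" if t: "t \<in> carrier (E j)" for t
  proof -
    have "\<bar>B (x(j := t))\<bar> \<le> P (abs_family (insert j I) E (x(j := t)))"
      using B riesz_prod_upd[OF x t] by (simp only: form_dominated_def)
    then show ?thesis using t abs_closed[OF t] by (simp only: abs_family_upd form_slice_def restrict_apply') 
  qed
  ultimately show ?thesis
    by (auto simp: order_dual_carrier_iff form_slice_def[of E j B] intro: dominated_order_bounded)
qed

text \<open>One step of the Arens extension for an arbitrary index set \<open>I\<close> and variable
  \<open>j\<close>, freed from \<open>m\<close>, \<open>\<rho>\<close> and \<open>k\<close>.\<close>

definition form_eval ::
  "nat set \<Rightarrow> (nat \<Rightarrow> 'a riesz) \<Rightarrow> nat \<Rightarrow> (('a \<Rightarrow> real) \<Rightarrow> real) \<Rightarrow> ((nat \<Rightarrow> 'a) \<Rightarrow> real) \<Rightarrow>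
     (nat \<Rightarrow> 'a) \<Rightarrow> real" where
  "form_eval I E j u B = (\<lambda>x\<in>riesz_prod I E. u (form_slice E j B x))"

lemma arens_bar_eq: "arens_bar m \<rho> E k = form_eval (arens_index m \<rho> k) E (\<rho> k)"
  by (simp add: fun_eq_iff arens_bar_def form_eval_def form_slice_def)

text \<open>For \<open>i \<noteq> j\<close> the slice depends linearly on the coordinate
  \<open>i\<close>, and \<open>u\<close> is linear on the order dual. Domination of \<open>B\<close>
  ensures that the slices lie there.\<close>

lemma multilinear_form_eval:
  assumes B: "form_dominated (insert j I) E P B" and E: "\<And>i. i \<in> insert j I \<Longrightarrow> riesz_space (E i)"
    and j: "j \<notin> I" and u: "u \<in> carrier (order_bidual (E j))"
  shows "multilinear I E real_riesz (form_eval I E j u B)"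
proof (rule multilinear_realI)
  fix x i a c assume x: "x \<in> riesz_prod I E" and i: "i \<in> I" and a: "a \<in> carrier (E i)"
  interpret riesz "E i" using E i by (simp add: riesz.intro)
  have ml: "multilinear (insert j I) E real_riesz B" using B by (simp add: form_dominated_def)
  have ij: "i \<noteq> j" using i j by blast
  note closed [simp] = riesz_prod_upd_same[OF x i]
  have slice: "form_slice E j B (x(i := a)) \<in> carrier (order_dual (E j))" if "a \<in> carrier (E i)" for a
    using that by (intro form_slice_closed[OF B E]) simp_all
  {
    fix b assume b: "b \<in> carrier (E i)"
    have "B (x(i := a \<boxplus>\<^bsub>E i\<^esub> b, j := t)) = B (x(i := a, j := t)) + B (x(i := b, j := t))"
      if "t \<in> carrier (E j)" for t
      using multilinear_realD(1)[OF ml riesz_prod_upd[OF x that], of i a b] i a b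
      by (simp add: fun_upd_twist[OF ij])
    then have "form_slice E j B (x(i := a \<boxplus>\<^bsub>E i\<^esub> b)) =
        form_slice E j B (x(i := a)) \<boxplus>\<^bsub>order_dual (E j)\<^esub> form_slice E j B (x(i := b))"
      by (auto simp: form_slice_def fun_eq_iff)
    then show "form_eval I E j u B (x(i := a \<boxplus>\<^bsub>E i\<^esub> b)) =
        form_eval I E j u B (x(i := a)) + form_eval I E j u B (x(i := b))"
      using a b order_dual_apply(1)[OF u slice[OF a] slice[OF b]] by (simp add: form_eval_def)
  }
  have "B (x(i := c \<cdot>\<^bsub>E i\<^esub> a, j := t)) = c * B (x(i := a, j := t))" if "t \<in> carrier (E j)" for t
    using multilinear_realD(2)[OF ml riesz_prod_upd[OF x that], of i a c] i a
    by (simp add: fun_upd_twist[OF ij])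
  then have "form_slice E j B (x(i := c \<cdot>\<^bsub>E i\<^esub> a)) = c \<cdot>\<^bsub>order_dual (E j)\<^esub> form_slice E j B (x(i := a))"
    by (auto simp: form_slice_def fun_eq_iff)
  then show "form_eval I E j u B (x(i := c \<cdot>\<^bsub>E i\<^esub> a)) = c * form_eval I E j u B (x(i := a))"
    using a order_dual_apply(2)[OF u slice[OF a]] by (simp add: form_eval_def)
qed

text \<open>On the positive cone the slices of \<open>B\<close> and of \<open>P\<close> at
  \<open>x\<close> are bounded by the slice of \<open>P\<close> at the absolute values of
  \<open>x\<close>; \<open>bidual_abs_dominates\<close> carries these bounds over to the values of
  \<open>u\<close> and \<open>|u|\<close>.\<close>

lemma form_dominated_form_eval:
  assumes B: "form_dominated (insert j I) E P B" and E: "\<And>i. i \<in> insert j I \<Longrightarrow> riesz_space (E i)"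
    and j: "j \<notin> I" and u: "u \<in> carrier (order_bidual (E j))"
  shows "form_dominated I E (form_eval I E j (riesz_abs (order_bidual (E j)) u) P) (form_eval I E j u B)"
proof -
  interpret riesz "E j" using E by (simp add: riesz.intro)
  interpret DD: riesz "order_bidual (E j)" by (intro riesz_order_dual riesz_space_order_dual)
  let ?v = "riesz_abs (order_bidual (E j)) u"
  note P = form_dominated_refl[OF B]
  have "\<bar>form_eval I E j u B x\<bar> \<le> form_eval I E j ?v P (abs_family I E x) \<and>
      \<bar>form_eval I E j ?v P x\<bar> \<le> form_eval I E j ?v P (abs_family I E x)" if x: "x \<in> riesz_prod I E" for x
  proof -
    have ax: "abs_family I E x \<in> riesz_prod I E" using E x by (intro abs_family_closed) auto
    have bound: "\<bar>form_slice E j C x t\<bar> \<le> form_slice E j P (abs_family I E x) t"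
      if "form_dominated (insert j I) E P C" "t \<in> carrier (E j)" "vzero (E j) \<sqsubseteq>\<^bsub>E j\<^esub> t" for C t
    proof -
      have "\<bar>C (x(j := t))\<bar> \<le> P (abs_family (insert j I) E (x(j := t)))"
        using that(1) riesz_prod_upd[OF x that(2)] by (simp only: form_dominated_def)
      then show ?thesis
        using that(2) by (simp only: abs_family_upd form_slice_def restrict_apply' abs_of_nonneg[OF that(3,2)])
    qed
    note slices = form_slice_closed[OF B E x] form_slice_closed[OF P E x] form_slice_closed[OF P E ax]
    show ?thesis
      using bidual_abs_dominates(1)[OF u slices(1,3) bound[OF B]]
        bidual_abs_dominates(2)[OF u slices(2,3) bound[OF P]] x ax
      by (simp add: form_eval_def)
  qed
  then show ?thesis
    using multilinear_form_eval[OF B E j u] multilinear_form_eval[OF P E j DD.abs_closed[OF u]]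
    by (simp add: form_dominated_def)
qed

text \<open>The slice of \<open>D\<close> is the same combination of the slices of \<open>B\<close>
  and \<open>C\<close>, to which linearity of \<open>u\<close> applies.\<close>

lemma form_eval_lincomb:
  assumes B: "form_dominated (insert j I) E P B" and C: "form_dominated (insert j I) E Q C"
    and E: "\<And>i. i \<in> insert j I \<Longrightarrow> riesz_space (E i)" and u: "u \<in> carrier (order_bidual (E j))"
    and D: "\<And>x. x \<in> riesz_prod (insert j I) E \<Longrightarrow> D x = b * B x + c * C x" and x: "x \<in> riesz_prod I E"
  shows "form_eval I E j u D x = b * form_eval I E j u B x + c * form_eval I E j u C x"
proof -
  interpret riesz "E j" using E by (simp add: riesz.intro)
  interpret D: riesz "order_dual (E j)" by (rule riesz_order_dual) unfold_locales
  let ?b = "form_slice E j B x" and ?c = "form_slice E j C x"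
  have [simp]: "?b \<in> carrier (order_dual (E j))" "?c \<in> carrier (order_dual (E j))"
    by (rule form_slice_closed[OF B E x] form_slice_closed[OF C E x]; assumption)+
  have "form_slice E j D x = b \<cdot>\<^bsub>order_dual (E j)\<^esub> ?b \<boxplus>\<^bsub>order_dual (E j)\<^esub> c \<cdot>\<^bsub>order_dual (E j)\<^esub> ?c"
    by (auto simp: form_slice_def fun_eq_iff D riesz_prod_upd[OF x])
  then have "u (form_slice E j D x) = b * u ?b + c * u ?c"
    by (simp only: order_dual_apply[OF u] D.vscale_closed \<open>?b \<in> _\<close> \<open>?c \<in> _\<close>)
  then show ?thesis using x by (simp add: form_eval_def)
qed

section \<open>Arens extensions of dominated forms\<close>

lemma arens_index_0 [simp]: "arens_index m \<rho> 0 = {1..m}"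
  by (simp add: arens_index_def)

lemma arens_index_Suc:
  assumes "\<rho> permutes {1..m}" "k < m"
  shows "arens_index m \<rho> k = insert (\<rho> (Suc k)) (arens_index m \<rho> (Suc k))"
    and "\<rho> (Suc k) \<notin> arens_index m \<rho> (Suc k)"
proof -
  have "\<rho> (Suc k) \<in> {1..m}" using assms permutes_in_image[OF assms(1), of "Suc k"] by simp
  moreover have "\<rho> (Suc k) \<notin> \<rho> ` {1..k}" using permutes_inj[OF assms(1)] by (auto simp: inj_eq)
  moreover have "{1..Suc k} = insert (Suc k) {1..k}" by auto
  ultimately show "arens_index m \<rho> k = insert (\<rho> (Suc k)) (arens_index m \<rho> (Suc k))"
    "\<rho> (Suc k) \<notin> arens_index m \<rho> (Suc k)"
    by (auto simp: arens_index_def)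
qed

lemma arens_index_full: "\<rho> permutes {1..m} \<Longrightarrow> arens_index m \<rho> m = {}"
  by (simp add: arens_index_def permutes_image)

context
  fixes m :: nat and \<rho> :: "nat \<Rightarrow> nat" and E :: "nat \<Rightarrow> 'a riesz" and x'' :: "nat \<Rightarrow> ('a \<Rightarrow> real) \<Rightarrow> real"
  assumes E: "\<And>i. i \<in> {1..m} \<Longrightarrow> riesz_space (E i)"
    and \<rho>: "\<rho> permutes {1..m}"
    and x'': "x'' \<in> riesz_prod {1..m} (\<lambda>i. order_bidual (E i))"
begin

lemma arens_step:
  assumes "Suc k \<le> m"
  shows "\<And>i. i \<in> insert (\<rho> (Suc k)) (arens_index m \<rho> (Suc k)) \<Longrightarrow> riesz_space (E i)"
    and "x'' (\<rho> (Suc k)) \<in> carrier (order_bidual (E (\<rho> (Suc k))))"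
    and "\<rho> (Suc k) \<in> {1..m}"
proof -
  show \<rho>k: "\<rho> (Suc k) \<in> {1..m}" using assms permutes_in_image[OF \<rho>, of "Suc k"] by simp
  then show "x'' (\<rho> (Suc k)) \<in> carrier (order_bidual (E (\<rho> (Suc k))))" using x'' by (auto simp: PiE_iff)
  show "riesz_space (E i)" if "i \<in> insert (\<rho> (Suc k)) (arens_index m \<rho> (Suc k))" for i
    using that E \<rho>k by (auto simp: arens_index_def)
qed

text \<open>Iterates \<open>form_dominated_form_eval\<close>. Intermediate values of
  \<open>k\<close> keep the slices in the order dual; \<open>k = m\<close> bounds the values of the
  Arens extension.\<close>

lemma arens_comp_dominated:
  assumes B: "form_dominated {1..m} E P B" and "k \<le> m"
  shows "form_dominated (arens_index m \<rho> k) E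
    (arens_comp m \<rho> E k (abs_family {1..m} (\<lambda>i. order_bidual (E i)) x'') P) (arens_comp m \<rho> E k x'' B)"
  using assms(2)
proof (induction k)
  case 0
  then show ?case using B by simp
next
  case (Suc k)
  then have "form_dominated (insert (\<rho> (Suc k)) (arens_index m \<rho> (Suc k))) E
    (arens_comp m \<rho> E k (abs_family {1..m} (\<lambda>i. order_bidual (E i)) x'') P) (arens_comp m \<rho> E k x'' B)"
    using arens_index_Suc(1)[OF \<rho>, of k] by (simp only: Suc_le_eq less_imp_le)
  then show ?case
    unfolding arens_comp.simps o_apply arens_bar_eq restrict_apply'[OF arens_step(3)[OF Suc.prems]]
    by (intro form_dominated_form_eval arens_step[OF Suc.prems] arens_index_Suc(2)[OF \<rho>]
        Suc_le_lessD[OF Suc.prems])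
qed

text \<open>This yields linearity of the Arens extension in the functional on
  \<open>F\<close>.\<close>

lemma arens_comp_lincomb:
  assumes B: "form_dominated {1..m} E P B" and C: "form_dominated {1..m} E Q C"
    and D: "\<And>x. x \<in> riesz_prod {1..m} E \<Longrightarrow> D x = b * B x + c * C x"
    and "k \<le> m" "x \<in> riesz_prod (arens_index m \<rho> k) E"
  shows "arens_comp m \<rho> E k x'' D x = b * arens_comp m \<rho> E k x'' B x + c * arens_comp m \<rho> E k x'' C x"
  using assms(4,5)
proof (induction k arbitrary: x)
  case 0
  then show ?case using D by simp
next
  case (Suc k)
  have k: "k \<le> m" "k < m" using Suc.prems by simp_all
  note idx = arens_index_Suc(1)[OF \<rho> k(2)]
  show ?case
    using form_eval_lincomb[OF arens_comp_dominated[OF B k(1), unfolded idx]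
        arens_comp_dominated[OF C k(1), unfolded idx] arens_step(1,2)[OF Suc.prems(1)]
        Suc.IH[OF k(1), unfolded idx] Suc.prems(2)]
    by (simp add: arens_bar_eq)
qed

text \<open>The slice in the variable \<open>j = \<rho> (Suc k)\<close> is a scalar multiple of
  \<open>\<phi> j\<close>, so each step replaces the factor \<open>\<phi> j (x j)\<close> by
  \<open>x'' j (\<phi> j)\<close>. At \<open>k = m\<close> the order prescribed by
  \<open>\<rho>\<close> has disappeared.\<close>

lemma arens_comp_prod:
  assumes \<phi>: "\<And>i. i \<in> {1..m} \<Longrightarrow> \<phi> i \<in> carrier (order_dual (E i))"
    and B: "\<And>x. x \<in> riesz_prod {1..m} E \<Longrightarrow> B x = c * (\<Prod>i\<in>{1..m}. \<phi> i (x i))"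
    and "k \<le> m" "x \<in> riesz_prod (arens_index m \<rho> k) E"
  shows "arens_comp m \<rho> E k x'' B x =
    c * (\<Prod>i\<in>\<rho> ` {1..k}. x'' i (\<phi> i)) * (\<Prod>i\<in>arens_index m \<rho> k. \<phi> i (x i))"
  using assms(3,4)
proof (induction k arbitrary: x)
  case 0
  then show ?case using B by simp
next
  case (Suc k)
  let ?j = "\<rho> (Suc k)" and ?I = "arens_index m \<rho> (Suc k)"
  have k: "k \<le> m" "k < m" using Suc.prems by simp_all
  note idx = arens_index_Suc[OF \<rho> k(2)]
  have fin: "finite ?I" by (simp add: arens_index_def)
  note j = arens_step(2,3)[OF Suc.prems(1)]
  let ?d = "c * (\<Prod>i\<in>\<rho> ` {1..k}. x'' i (\<phi> i)) * (\<Prod>i\<in>?I. \<phi> i (x i))"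
  have "arens_comp m \<rho> E k x'' B (x(?j := t)) = ?d * \<phi> ?j t" if "t \<in> carrier (E ?j)" for t
  proof -
    have "(\<Prod>i\<in>?I. \<phi> i ((x(?j := t)) i)) = (\<Prod>i\<in>?I. \<phi> i (x i))"
      using idx(2) by (intro prod.cong) auto
    moreover have "x(?j := t) \<in> riesz_prod (arens_index m \<rho> k) E"
      unfolding idx(1) using Suc.prems(2) that by (rule riesz_prod_upd)
    from Suc.IH[OF k(1) this] have "arens_comp m \<rho> E k x'' B (x(?j := t)) =
        c * (\<Prod>i\<in>\<rho> ` {1..k}. x'' i (\<phi> i)) * (\<Prod>i\<in>insert ?j ?I. \<phi> i ((x(?j := t)) i))"
      by (simp only: idx(1))
    ultimately show ?thesis using fin idx(2) by simp
  qed
  then have "form_slice E ?j (arens_comp m \<rho> E k x'' B) x = ?d \<cdot>\<^bsub>order_dual (E ?j)\<^esub> \<phi> ?j"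
    by (auto simp: form_slice_def fun_eq_iff)
  then have "arens_comp m \<rho> E (Suc k) x'' B x = ?d * x'' ?j (\<phi> ?j)"
    using Suc.prems(2) order_dual_apply(2)[OF j(1) \<phi>[OF j(2)], of ?d]
    by (simp add: arens_bar_eq form_eval_def)
  moreover have "{1..Suc k} = insert (Suc k) {1..k}" by auto
  then have "(\<Prod>i\<in>\<rho> ` {1..Suc k}. x'' i (\<phi> i)) = x'' ?j (\<phi> ?j) * (\<Prod>i\<in>\<rho> ` {1..k}. x'' i (\<phi> i))"
    using permutes_inj[OF \<rho>] by (auto simp: inj_eq intro!: prod.insert)
  ultimately show ?case by simp
qed

end

section \<open>Real Riesz multimorphisms are products\<close>

text \<open>The coordinates of \<open>x\<close> are replaced by those of \<open>y\<close> one at a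
  time. Replacing coordinate \<open>j\<close> adds the value of \<open>B\<close> at a positive
  family with \<open>y j - x j\<close> in place \<open>j\<close>.\<close>

lemma positive_form_mono:
  assumes B: "multilinear I E real_riesz B" and E: "\<And>i. i \<in> I \<Longrightarrow> riesz_space (E i)" and fin: "finite I"
    and pos: "\<And>x. \<lbrakk>x \<in> riesz_prod I E; \<And>i. i \<in> I \<Longrightarrow> vzero (E i) \<sqsubseteq>\<^bsub>E i\<^esub> x i\<rbrakk> \<Longrightarrow> 0 \<le> B x"
    and x: "x \<in> riesz_prod I E" "\<And>i. i \<in> I \<Longrightarrow> vzero (E i) \<sqsubseteq>\<^bsub>E i\<^esub> x i"
    and y: "y \<in> riesz_prod I E" "\<And>i. i \<in> I \<Longrightarrow> x i \<sqsubseteq>\<^bsub>E i\<^esub> y i"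
  shows "B x \<le> B y"
proof -
  have y0: "vzero (E i) \<sqsubseteq>\<^bsub>E i\<^esub> y i" if i: "i \<in> I" for i
  proof -
    interpret riesz "E i" using E i by (simp add: riesz.intro)
    show ?thesis using le_trans[OF x(2)[OF i] y(2)[OF i]] PiE_mem[OF x(1) i] PiE_mem[OF y(1) i] by simp
  qed
  let ?z = "\<lambda>S. override_on x y S"
  have zI: "?z S \<in> riesz_prod I E" if "S \<subseteq> I" for S
    using that x(1) y(1) by (auto simp: PiE_iff override_on_def extensional_def)
  have "B x \<le> B (?z S)" if "finite S" "S \<subseteq> I" for S
    using that
  proof (induction S)
    case empty
    then show ?case by simp
  next
    case (insert j S)
    then have j: "j \<in> I" "j \<notin> S" and S: "S \<subseteq> I" by simp_all
    interpret riesz "E j" using E j by (simp add: riesz.intro)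
    let ?d = "y j \<boxplus>\<^bsub>E j\<^esub> (-1) \<cdot>\<^bsub>E j\<^esub> x j"
    have xj: "x j \<in> carrier (E j)" "y j \<in> carrier (E j)" using x y j by auto
    have d: "?d \<in> carrier (E j)" using xj by simp
    have "0 \<le> B ((?z S)(j := ?d))"
    proof (rule pos)
      show "(?z S)(j := ?d) \<in> riesz_prod I E" by (rule riesz_prod_upd_same[OF zI[OF S] j(1) d])
      show "vzero (E i) \<sqsubseteq>\<^bsub>E i\<^esub> ((?z S)(j := ?d)) i" if "i \<in> I" for i
        using x(2)[OF that] y0[OF that] y(2)[OF j(1)] xj
        by (auto simp: override_on_def vminus_nonneg_iff)
    qed
    moreover have "y j = ?d \<boxplus>\<^bsub>E j\<^esub> x j" using xj by simp
    then have "B ((?z S)(j := y j)) = B ((?z S)(j := ?d)) + B ((?z S)(j := x j))"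
      using multilinear_realD(1)[OF B zI[OF S] j(1) d xj(1)] by simp
    moreover have "(?z S)(j := y j) = ?z (insert j S)" "(?z S)(j := x j) = ?z S"
      using j by (auto simp: override_on_def)
    ultimately show ?case using insert.IH S by simp
  qed
  from this[OF fin] have "B x \<le> B (?z I)" by simp
  moreover have "?z I = y" using x y by (auto simp: override_on_def fun_eq_iff PiE_iff extensional_def)
  ultimately show ?thesis by simp
qed

text \<open>For a positive family \<open>e\<close> with \<open>B e > 0\<close>, the slices of
  \<open>B\<close> in variable \<open>j\<close> at any \<open>x\<close> and at \<open>e\<close> are
  proportional. Exchanging the coordinates of \<open>e\<close> for those of \<open>x\<close> one at
  a time splits off the factors \<open>\<phi> j (x j)\<close> and leaves
  \<open>c = B e\<close>.\<close>

lemma real_multimorphism_prod: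
  assumes B: "multilinear I E real_riesz B" and E: "\<And>i. i \<in> I \<Longrightarrow> riesz_space (E i)" and fin: "finite I"
    and abs: "\<And>x. x \<in> riesz_prod I E \<Longrightarrow> \<bar>B x\<bar> = B (abs_family I E x)"
  obtains c \<phi> where "0 \<le> c"
    "\<And>i. i \<in> I \<Longrightarrow> \<phi> i \<in> carrier (order_dual (E i))"
    "\<And>i t. \<lbrakk>i \<in> I; t \<in> carrier (E i)\<rbrakk> \<Longrightarrow> \<phi> i (riesz_abs (E i) t) = \<bar>\<phi> i t\<bar>"
    "\<And>x. x \<in> riesz_prod I E \<Longrightarrow> B x = c * (\<Prod>i\<in>I. \<phi> i (x i))"
proof (cases "\<exists>x\<in>riesz_prod I E. B x \<noteq> 0")
  case False
  have z: "(\<lambda>x\<in>carrier (E i). 0) \<in> carrier (order_dual (E i))" if "i \<in> I" for i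
    using E[OF that] by (intro riesz.dual_vzero_closed riesz.intro)
  have az: "(\<lambda>x\<in>carrier (E i). 0) (riesz_abs (E i) t) = (0::real)" if "i \<in> I" "t \<in> carrier (E i)" for i t
    using E[OF that(1)] that(2) by (simp add: riesz.intro riesz.abs_closed)
  show thesis
    by (rule that[of 0 "\<lambda>i. \<lambda>x\<in>carrier (E i). 0"]) (use False z az in auto)
next
  case True
  then obtain e' where e': "e' \<in> riesz_prod I E" "B e' \<noteq> 0" by blast
  \<comment> \<open>Taking absolute values turns a point where \<open>B\<close> is nonzero into a
    positive family with \<open>B e = |B e'| > 0\<close>.\<close>
  define e where "e = abs_family I E e'"
  have e: "e \<in> riesz_prod I E" unfolding e_def by (rule abs_family_closed[OF E e'(1)])
  have Be: "0 < B e" using abs[OF e'(1)] e'(2) by (simp add: e_def)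
  have riesz: "riesz (E i)" if "i \<in> I" for i using E[OF that] by (rule riesz.intro)
  have ei: "e i \<in> carrier (E i)" if "i \<in> I" for i using e that by auto
  have e0: "vzero (E i) \<sqsubseteq>\<^bsub>E i\<^esub> e i" if "i \<in> I" for i
    using e'(1) that by (auto simp: e_def intro!: riesz.abs_nonneg[OF riesz])
  have pos: "0 \<le> B x" if x: "x \<in> riesz_prod I E" "\<And>i. i \<in> I \<Longrightarrow> vzero (E i) \<sqsubseteq>\<^bsub>E i\<^esub> x i" for x
  proof -
    have "abs_family I E x = x"
      using x by (auto simp: fun_eq_iff PiE_iff extensional_def riesz.abs_of_nonneg[OF riesz])
    then show ?thesis using abs[OF x(1)] by simp
  qed
  note mono = positive_form_mono[OF B E fin pos]
  have upd: "x(j := t) \<in> riesz_prod I E" if "x \<in> riesz_prod I E" "j \<in> I" "t \<in> carrier (E j)" for x j t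
    using that by (rule riesz_prod_upd_same)
  have absupd: "\<bar>B (x(j := t))\<bar> = B ((abs_family I E x)(j := riesz_abs (E j) t))"
    if "x \<in> riesz_prod I E" "j \<in> I" "t \<in> carrier (E j)" for x j t
    using abs[OF upd[OF that]] abs_family_upd[where j = j and I = I and E = E and x = x and t = t] that(2) by (simp add: insert_absorb)
  have lin: "riesz_linear (E j) real_riesz (\<lambda>t. B (x(j := t)))" if "x \<in> riesz_prod I E" "j \<in> I" for x j
    using multilinear_partial[of j I E B x] B E that by (simp add: insert_absorb)
  have abse: "abs_family I E e = e"
    using e e0 ei by (auto simp: fun_eq_iff PiE_iff extensional_def riesz.abs_of_nonneg[OF riesz])
  have swap: "B (x(j := s)) * B (e(j := t)) = B (x(j := t)) * B (e(j := s))"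
    if x: "x \<in> riesz_prod I E" and j: "j \<in> I" and st: "s \<in> carrier (E j)" "t \<in> carrier (E j)" for x j s t
  proof -
    interpret J: riesz "E j" by (rule riesz[OF j])
    \<comment> \<open>The family \<open>w = |x| + e\<close> lies above both \<open>|x|\<close> and
      \<open>e\<close>, so the slice at \<open>w\<close> dominates the slices at \<open>x\<close>
      and at \<open>e\<close>.\<close>
    define w where "w = (\<lambda>i\<in>I. riesz_abs (E i) (x i) \<boxplus>\<^bsub>E i\<^esub> e i)"
    have cl: "riesz_abs (E i) (x i) \<in> carrier (E i)" "vzero (E i) \<sqsubseteq>\<^bsub>E i\<^esub> riesz_abs (E i) (x i)"
      "w i \<in> carrier (E i)" "riesz_abs (E i) (x i) \<sqsubseteq>\<^bsub>E i\<^esub> w i" "e i \<sqsubseteq>\<^bsub>E i\<^esub> w i"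
      "vzero (E i) \<sqsubseteq>\<^bsub>E i\<^esub> w i" if i: "i \<in> I" for i
    proof -
      interpret riesz "E i" by (rule riesz[OF i])
      have xi: "x i \<in> carrier (E i)" using x i by auto
      note [simp] = xi ei[OF i] abs_nonneg[OF xi] e0[OF i]
      show "riesz_abs (E i) (x i) \<in> carrier (E i)" "vzero (E i) \<sqsubseteq>\<^bsub>E i\<^esub> riesz_abs (E i) (x i)" "w i \<in> carrier (E i)"
        using i by (simp_all add: w_def)
      show "riesz_abs (E i) (x i) \<sqsubseteq>\<^bsub>E i\<^esub> w i"
        using vadd_mono_both[of "riesz_abs (E i) (x i)" "riesz_abs (E i) (x i)" "vzero (E i)" "e i"] i
        by (simp add: w_def)
      show "e i \<sqsubseteq>\<^bsub>E i\<^esub> w i"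
        using vadd_mono_both[of "vzero (E i)" "riesz_abs (E i) (x i)" "e i" "e i"] i
        by (simp add: w_def)
      show "vzero (E i) \<sqsubseteq>\<^bsub>E i\<^esub> w i" using i by (simp add: w_def vadd_nonneg)
    qed
    have w: "w \<in> riesz_prod I E" using cl by (auto simp: w_def)
    have absw: "abs_family I E w = w"
      using cl w by (auto simp: fun_eq_iff PiE_iff extensional_def riesz.abs_of_nonneg[OF riesz])
    have dom: "B (v(j := riesz_abs (E j) t)) \<le> B (w(j := riesz_abs (E j) t))"
      if t: "t \<in> carrier (E j)" and v: "v \<in> riesz_prod I E"
        and v0: "\<And>i. i \<in> I \<Longrightarrow> vzero (E i) \<sqsubseteq>\<^bsub>E i\<^esub> v i" and vw: "\<And>i. i \<in> I \<Longrightarrow> v i \<sqsubseteq>\<^bsub>E i\<^esub> w i" for v t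
      by (rule mono) (use t v0 vw J.abs_nonneg[OF t] upd[OF v j] upd[OF w j] in auto)
    show ?thesis
    proof (rule J.dominated_swap[OF lin[OF x j] lin[OF e j] lin[OF w j] _ _ st])
      fix t assume t: "t \<in> carrier (E j)"
      show "\<bar>B (x(j := t))\<bar> \<le> \<bar>B (w(j := t))\<bar>"
        unfolding absupd[OF x j t] absupd[OF w j t] absw
        by (rule dom[OF t abs_family_closed[OF E x]]) (use cl in auto)
      show "\<bar>B (e(j := t))\<bar> \<le> \<bar>B (w(j := t))\<bar>"
        unfolding absupd[OF e j t] absupd[OF w j t] absw abse
        by (rule dom[OF t e]) (use cl e0 in auto)
    qed
  qed
  \<comment> \<open>The slices at \<open>e\<close> are normalised so that
    \<open>\<phi> i (e i) = 1\<close>.\<close>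
  define \<phi> where "\<phi> i = (\<lambda>t\<in>carrier (E i). B (e(i := t)) / B e)" for i
  have \<phi>abs: "\<phi> i (riesz_abs (E i) t) = \<bar>\<phi> i t\<bar>" if "i \<in> I" "t \<in> carrier (E i)" for i t
    using absupd[OF e that] abse Be riesz.abs_closed[OF riesz[OF that(1)] that(2)] that(2)
    by (simp add: \<phi>_def)
  have \<phi>: "\<phi> i \<in> carrier (order_dual (E i))" if i: "i \<in> I" for i
  proof -
    interpret riesz "E i" by (rule riesz[OF i])
    have l: "riesz_linear (E i) real_riesz (\<phi> i)"
      using lin[OF e i] by (simp add: riesz_linear_real_iff \<phi>_def add_divide_distrib)
    have "order_bounded (E i) (\<phi> i)"
      by (rule dominated_order_bounded[OF l l]) (simp add: \<phi>abs[OF i])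
    with l show ?thesis by (simp add: order_dual_carrier_iff \<phi>_def)
  qed
  have "B x = B e * (\<Prod>i\<in>I. \<phi> i (x i))" if x: "x \<in> riesz_prod I E" for x
  proof -
    have zI: "override_on e x S \<in> riesz_prod I E" if "S \<subseteq> I" for S
      using that x e by (auto simp: PiE_iff override_on_def extensional_def)
    have "B (override_on e x S) = B e * (\<Prod>i\<in>S. \<phi> i (x i))" if "finite S" "S \<subseteq> I" for S
      using that
    proof (induction S)
      case empty
      then show ?case by simp
    next
      case (insert j S)
      then have j: "j \<in> I" "j \<notin> S" and S: "S \<subseteq> I" by simp_all
      have xj: "x j \<in> carrier (E j)" using x j by auto
      let ?z = "override_on e x S"
      have "?z(j := x j) = override_on e x (insert j S)" "?z(j := e j) = ?z"
        using j by (auto simp: override_on_def)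
      \<comment> \<open>This is \<open>swap\<close> at \<open>?z\<close> with \<open>s = x j\<close>
        and \<open>t = e j\<close>, since \<open>e(j := e j) = e\<close>.\<close>
      then have "B (override_on e x (insert j S)) * B e = B ?z * B (e(j := x j))"
        using swap[OF zI[OF S] j(1) xj ei[OF j(1)]] by simp
      then have "B (override_on e x (insert j S)) = B ?z * \<phi> j (x j)"
        using Be xj by (simp add: \<phi>_def field_simps)
      then show ?case using insert by simp
    qed
    from this[OF fin] have "B (override_on e x I) = B e * (\<Prod>i\<in>I. \<phi> i (x i))" by simp
    moreover have "override_on e x I = x"
      using x e by (auto simp: override_on_def fun_eq_iff PiE_iff extensional_def)
    ultimately show ?thesis by simp
  qed
  with Be \<phi> \<phi>abs show thesis by (intro that[of "B e" \<phi>]) simp_all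
qed

section \<open>Arens extensions of Riesz multimorphisms\<close>

text \<open>Regularity describes \<open>A\<close> only as a difference \<open>P - N\<close> on the
  product; its values lie in \<open>F\<close> because those of \<open>P\<close> and \<open>N\<close>
  do.\<close>

lemma riesz_multimorphism_closed:
  assumes A: "riesz_multimorphism I E F A" and F: "riesz_space F" and x: "x \<in> riesz_prod I E"
  shows "A x \<in> carrier F"
proof -
  interpret riesz F using F by (rule riesz.intro)
  show ?thesis
    using A x unfolding riesz_multimorphism_def regular_multilinear_def positive_multilinear_def multilinear_def
    by (metis (no_types, lifting) PiE funcset_mem vadd_closed vscale_closed)
qed

lemma multilinear_compose:
  assumes A: "riesz_multimorphism I E F A" and F: "riesz_space F"
    and E: "\<And>i. i \<in> I \<Longrightarrow> riesz_space (E i)" and w: "w \<in> carrier (order_dual F)"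
  shows "multilinear I E real_riesz (compose (riesz_prod I E) w A)"
proof -
  interpret riesz F using F by (rule riesz.intro)
  obtain P N where P: "multilinear I E F P" and N: "multilinear I E F N"
    and PN: "\<And>x. x \<in> riesz_prod I E \<Longrightarrow> A x = P x \<boxplus>\<^bsub>F\<^esub> (-1) \<cdot>\<^bsub>F\<^esub> N x"
    using A unfolding riesz_multimorphism_def regular_multilinear_def positive_multilinear_def by blast
  have Pc: "P x \<in> carrier F" "N x \<in> carrier F" if "x \<in> riesz_prod I E" for x
    using P N that unfolding multilinear_def by blast+
  \<comment> \<open>Multilinearity is obtained through \<open>P\<close> and \<open>N\<close>, whose
    multilinearity is part of the definition of regularity.\<close>
  have wA: "compose (riesz_prod I E) w A x = w (P x) - w (N x)" if "x \<in> riesz_prod I E" for x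
    using that Pc[OF that] by (simp add: compose_def PN order_dual_apply[OF w])
  show ?thesis
  proof (rule multilinear_realI)
    fix x i u c assume x: "x \<in> riesz_prod I E" and i: "i \<in> I" and u: "u \<in> carrier (E i)"
    interpret Ei: riesz "E i" using E[OF i] by (rule riesz.intro)
    note upd = riesz_prod_upd_same[OF x i]
    {
      fix v assume v: "v \<in> carrier (E i)"
      have "P (x(i := u \<boxplus>\<^bsub>E i\<^esub> v)) = P (x(i := u)) \<boxplus>\<^bsub>F\<^esub> P (x(i := v))"
        "N (x(i := u \<boxplus>\<^bsub>E i\<^esub> v)) = N (x(i := u)) \<boxplus>\<^bsub>F\<^esub> N (x(i := v))"
        using P N x i u v unfolding multilinear_def by blast+
      then show "compose (riesz_prod I E) w A (x(i := u \<boxplus>\<^bsub>E i\<^esub> v)) =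
          compose (riesz_prod I E) w A (x(i := u)) + compose (riesz_prod I E) w A (x(i := v))"
        using u v by (simp add: wA upd Pc order_dual_apply[OF w])
    }
    have "P (x(i := c \<cdot>\<^bsub>E i\<^esub> u)) = c \<cdot>\<^bsub>F\<^esub> P (x(i := u))" "N (x(i := c \<cdot>\<^bsub>E i\<^esub> u)) = c \<cdot>\<^bsub>F\<^esub> N (x(i := u))"
      using P N x i u unfolding multilinear_def by blast+
    then show "compose (riesz_prod I E) w A (x(i := c \<cdot>\<^bsub>E i\<^esub> u)) = c * compose (riesz_prod I E) w A (x(i := u))"
      using u by (simp add: wA upd Pc order_dual_apply[OF w] algebra_simps)
  qed
qed

text \<open>By \<open>dual_abs_le\<close>, \<open>|w (A x)| \<le> v |A x|\<close>, and the
  multimorphism property moves the absolute value inside \<open>A\<close>.\<close>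

lemma form_dominated_compose:
  assumes A: "riesz_multimorphism I E F A" and F: "riesz_space F"
    and E: "\<And>i. i \<in> I \<Longrightarrow> riesz_space (E i)"
    and w: "w \<in> carrier (order_dual F)" and v: "v \<in> carrier (order_dual F)"
    and wv: "\<And>t. t \<in> carrier F \<Longrightarrow> vzero F \<sqsubseteq>\<^bsub>F\<^esub> t \<Longrightarrow> \<bar>w t\<bar> \<le> v t"
  shows "form_dominated I E (compose (riesz_prod I E) v A) (compose (riesz_prod I E) w A)"
proof -
  interpret riesz F using F by (rule riesz.intro)
  have "\<bar>u (A x)\<bar> \<le> v (A (abs_family I E x))"
    if "x \<in> riesz_prod I E" "u \<in> carrier (order_dual F)"
      "\<And>t. t \<in> carrier F \<Longrightarrow> vzero F \<sqsubseteq>\<^bsub>F\<^esub> t \<Longrightarrow> \<bar>u t\<bar> \<le> v t" for x u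
    using dual_abs_le[OF that(2) v that(3) riesz_multimorphism_closed[OF A F that(1)]] A that(1)
    by (simp add: riesz_multimorphism_def)
  moreover have "\<bar>v t\<bar> \<le> v t" if "t \<in> carrier F" "vzero F \<sqsubseteq>\<^bsub>F\<^esub> t" for t
    using wv[OF that] by simp
  ultimately show ?thesis
    using multilinear_compose[OF A F E] w v wv abs_family_closed[OF E]
    by (simp add: form_dominated_def compose_def)
qed

text \<open>Linearity comes from \<open>arens_comp_lincomb\<close>. Order boundedness holds because
  the value at \<open>w\<close> is bounded by the extension at the absolute values of
  \<open>x''\<close>, evaluated at \<open>|w|\<close>.\<close>

lemma arens_extension_closed:
  assumes E: "\<And>i. i \<in> {1..m} \<Longrightarrow> riesz_space (E i)" and F: "riesz_space F"
    and A: "riesz_multimorphism {1..m} E F A" and \<rho>: "\<rho> permutes {1..m}"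
    and x'': "x'' \<in> riesz_prod {1..m} (\<lambda>i. order_bidual (E i))"
  shows "arens_extension m \<rho> E F A x'' \<in> carrier (order_bidual F)"
proof -
  interpret riesz F using F by (rule riesz.intro)
  interpret D: riesz "order_dual F" by (rule riesz_order_dual[OF F])
  let ?G = "arens_extension m \<rho> E F A" and ?c = "\<lambda>w. compose (riesz_prod {1..m} E) w A"
  let ?a = "abs_family {1..m} (\<lambda>i. order_bidual (E i)) x''"
  have a: "?a \<in> riesz_prod {1..m} (\<lambda>i. order_bidual (E i))"
    by (rule abs_family_closed[OF _ x''])
      (intro riesz.riesz_space_order_dual riesz.intro E; assumption)
  have dom: "form_dominated {1..m} E (?c (riesz_abs (order_dual F) w)) (?c w)"
    if w: "w \<in> carrier (order_dual F)" for w
    by (rule form_dominated_compose[OF A F E w D.abs_closed[OF w]])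
      (use D.le_abs[OF w] D.neg_le_abs[OF w] in \<open>auto simp: abs_le_iff\<close>)
  have empty: "(\<lambda>_. undefined) \<in> riesz_prod (arens_index m \<rho> m) E"
    by (simp add: arens_index_full[OF \<rho>])
  \<comment> \<open>The coefficients 1, 1 give additivity and the coefficients \<open>c\<close>, 0
    give homogeneity.\<close>
  have lincomb: "?G z'' u = b * ?G z'' v + c * ?G z'' w"
    if z'': "z'' \<in> riesz_prod {1..m} (\<lambda>i. order_bidual (E i))"
      and v: "v \<in> carrier (order_dual F)" and w: "w \<in> carrier (order_dual F)" and u: "u \<in> carrier (order_dual F)"
      and uvw: "\<And>t. t \<in> carrier F \<Longrightarrow> u t = b * v t + c * w t" for z'' u v w b c
    using arens_comp_lincomb[OF E \<rho> z'' dom[OF v] dom[OF w] _ order_refl empty, of "?c u" b c] u v w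
      uvw riesz_multimorphism_closed[OF A F]
    by (simp add: arens_extension_def compose_def)
  have lin: "riesz_linear (order_dual F) real_riesz (?G z'')"
    if z'': "z'' \<in> riesz_prod {1..m} (\<lambda>i. order_bidual (E i))" for z''
    unfolding riesz_linear_real_iff
  proof (intro conjI ballI allI)
    fix v w assume v: "v \<in> carrier (order_dual F)" and w: "w \<in> carrier (order_dual F)"
    show "?G z'' (v \<boxplus>\<^bsub>order_dual F\<^esub> w) = ?G z'' v + ?G z'' w"
      using lincomb[OF z'' v w D.vadd_closed[OF v w], of 1 1] by simp
  next
    fix c w assume w: "w \<in> carrier (order_dual F)"
    show "?G z'' (c \<cdot>\<^bsub>order_dual F\<^esub> w) = c * ?G z'' w"
      using lincomb[OF z'' w w D.vscale_closed[OF w], of c c 0] by simp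
  qed
  have "order_bounded (order_dual F) (?G x'')"
  proof (rule D.dominated_order_bounded[OF lin[OF x''] lin[OF a]])
    fix w assume w: "w \<in> carrier (order_dual F)"
    show "\<bar>?G x'' w\<bar> \<le> ?G ?a (riesz_abs (order_dual F) w)"
      using arens_comp_dominated[OF E \<rho> x'' dom[OF w] order_refl] w D.abs_closed[OF w]
      by (simp add: form_dominated_def arens_index_full[OF \<rho>] arens_extension_def)
  qed
  with lin[OF x''] show ?thesis
    by (simp add: order_dual_carrier_iff[of _ "order_dual F"]) (simp add: arens_extension_def)
qed

theorem proposition3p4:
  fixes m :: nat and \<rho> :: "nat \<Rightarrow> nat"
    and E :: "nat \<Rightarrow> 'a riesz" and F :: "'b riesz"
    and A :: "(nat \<Rightarrow> 'a) \<Rightarrow> 'b" and y' :: "'b \<Rightarrow> real"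
  assumes "\<And>i. i \<in> {1..m} \<Longrightarrow> riesz_space (E i)"
    and "riesz_space F"
    and "riesz_multimorphism {1..m} E F A"
    and "\<rho> permutes {1..m}"
    and "y' \<in> carrier (order_dual F)"
    and "riesz_hom F real_riesz y'"
  shows "riesz_multimorphism {1..m} (\<lambda>i. order_bidual (E i)) real_riesz
           (canonical_op (order_dual F) y' \<circ> arens_extension m \<rho> E F A) \<and>
         (\<forall>x''\<in>riesz_prod {1..m} (\<lambda>i. order_bidual (E i)).
            riesz_abs (order_bidual F) (arens_extension m \<rho> E F A x'') y' =
            arens_extension m \<rho> E F A (\<lambda>i\<in>{1..m}. riesz_abs (order_bidual (E i)) (x'' i)) y')"
proof -
  note E = assms(1) and F = assms(2) and A = assms(3) and \<rho> = assms(4) and y' = assms(5)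
  interpret riesz F using F by (rule riesz.intro)
  let ?I = "{1..m}" and ?EE = "\<lambda>i. order_bidual (E i)"
  let ?G = "arens_extension m \<rho> E F A"
  let ?H = "canonical_op (order_dual F) y' \<circ> ?G"
  let ?B = "compose (riesz_prod ?I E) y' A"
  have EE: "riesz_space (?EE i)" if "i \<in> ?I" for i
    by (intro riesz.riesz_space_order_dual riesz.intro E that)
  have ac: "abs_family ?I ?EE x'' \<in> riesz_prod ?I ?EE" if "x'' \<in> riesz_prod ?I ?EE" for x''
    by (rule abs_family_closed[OF EE that])
  have yabs: "y' (riesz_abs F t) = \<bar>y' t\<bar>" if "t \<in> carrier F" for t
    by (rule riesz_hom_abs[OF assms(6) F that])
  \<comment> \<open>The form \<open>?B\<close> inherits the multimorphism identity:
    \<open>|y' (A x)| = y' |A x|\<close>, which is \<open>y'\<close> of \<open>A\<close> at the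
    absolute values.\<close>
  have Babs: "\<bar>?B x\<bar> = ?B (abs_family ?I E x)" if "x \<in> riesz_prod ?I E" for x
    using that A yabs[OF riesz_multimorphism_closed[OF A F that]] abs_family_closed[OF E that]
    by (simp add: compose_def riesz_multimorphism_def)
  obtain c \<phi> where c: "0 \<le> c"
    and \<phi>: "\<And>i. i \<in> ?I \<Longrightarrow> \<phi> i \<in> carrier (order_dual (E i))"
    and \<phi>abs: "\<And>i t. \<lbrakk>i \<in> ?I; t \<in> carrier (E i)\<rbrakk> \<Longrightarrow> \<phi> i (riesz_abs (E i) t) = \<bar>\<phi> i t\<bar>"
    and B: "\<And>x. x \<in> riesz_prod ?I E \<Longrightarrow> ?B x = c * (\<Prod>i\<in>?I. \<phi> i (x i))"
    using real_multimorphism_prod[OF multilinear_compose[OF A F E y'] E finite_atLeastAtMost Babs] by blast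
  have G: "?G x'' y' = c * (\<Prod>i\<in>?I. x'' i (\<phi> i))" if x'': "x'' \<in> riesz_prod ?I ?EE" for x''
    using arens_comp_prod[OF E \<rho> x'' \<phi> B order_refl, of "\<lambda>_. undefined"] y'
    unfolding permutes_image[OF \<rho>] by (simp add: arens_extension_def arens_index_full[OF \<rho>])
  have Gc: "?G x'' \<in> carrier (order_bidual F)" if "x'' \<in> riesz_prod ?I ?EE" for x''
    by (rule arens_extension_closed[OF E F A \<rho> that])
  have HG: "?H x'' = ?G x'' y'" if "x'' \<in> riesz_prod ?I ?EE" for x''
    using Gc[OF that] by (simp add: canonical_op_def)
  \<comment> \<open>In the product formula each factor satisfies
    \<open>|x'' i| (\<phi> i) = |x'' i (\<phi> i)|\<close>, and \<open>c \<ge> 0\<close>.\<close>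
  have Gabs: "\<bar>?G x'' y'\<bar> = ?G (abs_family ?I ?EE x'') y'" if x'': "x'' \<in> riesz_prod ?I ?EE" for x''
  proof -
    have "riesz_abs (?EE i) (x'' i) (\<phi> i) = \<bar>x'' i (\<phi> i)\<bar>" if i: "i \<in> ?I" for i
      using x'' i by (intro riesz.bidual_abs_apply riesz.intro E \<phi> \<phi>abs) auto
    then show ?thesis
      unfolding G[OF x''] G[OF ac[OF x'']] using c by (simp add: abs_mult abs_prod)
  qed
  have ml: "multilinear ?I ?EE real_riesz ?H"
  proof (rule multilinear_realI)
    fix x'' i u d assume x'': "x'' \<in> riesz_prod ?I ?EE" and i: "i \<in> ?I" and u: "u \<in> carrier (?EE i)"
    interpret Ei: riesz "?EE i" using EE[OF i] by (rule riesz.intro)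
    \<comment> \<open>Isolating the factor of index \<open>i\<close> shows that \<open>?H\<close> is
      linear in that coordinate.\<close>
    have Hupd: "?H (x''(i := t)) = c * (t (\<phi> i) * (\<Prod>k\<in>?I - {i}. x'' k (\<phi> k)))" if t: "t \<in> carrier (?EE i)" for t
    proof -
      have "?H (x''(i := t)) = c * (\<Prod>k\<in>?I. (x''(i := t)) k (\<phi> k))"
        using HG[OF riesz_prod_upd_same[OF x'' i t]] G[OF riesz_prod_upd_same[OF x'' i t]] by simp
      then show ?thesis using prod.remove[OF _ i, of "\<lambda>k. (x''(i := t)) k (\<phi> k)"] by simp
    qed
    show "?H (x''(i := u \<boxplus>\<^bsub>?EE i\<^esub> v)) = ?H (x''(i := u)) + ?H (x''(i := v))" if v: "v \<in> carrier (?EE i)" for v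
      unfolding Hupd[OF Ei.vadd_closed[OF u v]] Hupd[OF u] Hupd[OF v] using \<phi>[OF i] by (simp add: algebra_simps)
    show "?H (x''(i := d \<cdot>\<^bsub>?EE i\<^esub> u)) = d * ?H (x''(i := u))"
      unfolding Hupd[OF Ei.vscale_closed[OF u]] Hupd[OF u] using \<phi>[OF i] by simp
  qed
  \<comment> \<open>A positive family equals its family of absolute values, so \<open>Gabs\<close>
    makes \<open>?H x''\<close> equal to its own absolute value. Hence \<open>?H\<close> is regular
    with zero as negative summand.\<close>
  have "0 \<le> ?H x''" if x'': "x'' \<in> riesz_prod ?I ?EE" and pos: "\<forall>i\<in>?I. vzero (?EE i) \<sqsubseteq>\<^bsub>?EE i\<^esub> x'' i" for x''
  proof -
    have "abs_family ?I ?EE x'' = x''"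
    proof (rule extensionalityI[of _ ?I])
      show "abs_family ?I ?EE x'' i = x'' i" if i: "i \<in> ?I" for i
        using riesz.abs_of_nonneg[OF riesz.intro[OF EE[OF i]], of "x'' i"] pos PiE_mem[OF x'' i] i by simp
    qed (use x'' in \<open>auto simp: PiE_iff\<close>)
    then show ?thesis using Gabs[OF x''] HG[OF x''] by simp
  qed
  moreover have "positive_multilinear ?I ?EE real_riesz (\<lambda>_. 0)"
    by (simp add: positive_multilinear_def multilinear_def)
  ultimately have "regular_multilinear ?I ?EE real_riesz ?H"
    unfolding regular_multilinear_def using ml
    by (intro exI[of _ ?H] exI[of _ "\<lambda>_. 0"]) (simp add: positive_multilinear_def del: o_apply)
  moreover have "riesz_abs real_riesz (?H x'') = ?H (abs_family ?I ?EE x'')" if "x'' \<in> riesz_prod ?I ?EE" for x''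
    unfolding riesz_abs_real_riesz HG[OF that] HG[OF ac[OF that]] by (rule Gabs[OF that])
  \<comment> \<open>As \<open>y'\<close> is a Riesz homomorphism, \<open>bidual_abs_apply\<close> at
    \<open>y'\<close> moves the absolute value outside the evaluation, and \<open>Gabs\<close>
    concludes.\<close>
  moreover have "riesz_abs (order_bidual F) (?G x'') y' = ?G (abs_family ?I ?EE x'') y'"
    if "x'' \<in> riesz_prod ?I ?EE" for x''
    using bidual_abs_apply[OF y' yabs Gc[OF that]] Gabs[OF that] by simp
  ultimately show ?thesis by (simp add: riesz_multimorphism_def del: o_apply)
qed

end
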